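(* Let $(M,\omega)$ be a symplectic manifold with a star product $*$ on $C^\infty(M)((\hbar^{\mathbb{Q}}))$, let $\rho:C^{\infty}(M)((\hbar^{\mathbb{Q}}))\to\mathbb{C}((\hbar^{\mathbb{Q}}))$ be a state, and let $X_1,\dots,X_{2m}\in C^{\infty}(M)((\hbar^{\mathbb{Q}}))$ satisfy $\overline{X_j}=X_j$, $j=1,\dots,2m$. Put $\delta X_j:=X_j-\rho(X_j)$ and, for $\alpha=1,\dots,m$, $$\delta A_\alpha:=\tfrac12(\delta X_\alpha+i\,\delta X_{\alpha+m}),\qquad \overline{\delta A_\alpha}=\tfrac12(\delta X_\alpha-i\,\delta X_{\alpha+m}).$$ Suppose there exist $u_{\alpha\beta},v_{\alpha\beta}\in\mathbb{C}((\hbar^{\mathbb{Q}}))$, $\alpha,\beta=1,\dots,m$, such that $$\det\begin{pmatrix}(u_{\alpha\beta})&(v_{\alpha\beta})\\ (\overline{v_{\alpha\beta}})&(\overline{u_{\alpha\beta}})\end{pmatrix}\ne0$$ and such that the elements $$\delta A'_\alpha:=\sum_{\beta=1}^m\big(u_{\alpha\beta}\,\delta A_\beta+v_{\alpha\beta}\,\overline{\delta A_\beta}\big),\qquad \alpha=1,\dots,m,$$ (so that $\overline{\delta A'_\alpha}=\sum_{\beta=1}^m(\overline{v_{\alpha\beta}}\,\delta A_\beta+\overline{u_{\alpha\beta}}\,\overline{\delta A_\beta})$) satisfy $\rho(\overline{\delta A'_\alpha}*\delta A'_\alpha)=0$ for all $\alpha=1,\dots,m$. Then $$\det\Big(\tfrac12\rho(\delta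 X_j*\delta X_k+\delta X_k*\delta X_j)\Big)_{j,k=1}^{2m}=\det\Big(\tfrac{\hbar}{2}\rho(\{X_j,X_k\}_* )\Big)_{j,k=1}^{2m},$$ i.e., $\rho$ is a Robertson–Schrödinger intelligent state for $X_1,\dots,X_{2m}$. Here $\{X_j,X_k\}_*:=\frac{1}{i\hbar}(X_j*X_k-X_k*X_j)$.
   Context: For a field $\mathbb{K}$, $\mathbb{K}((\hbar^{\mathbb{Q}}))$ is the field of formal series $a=\sum_{q\in\mathbb{Q}}a_q\hbar^q$, $a_q\in\mathbb{K}$, whose support $\{q:a_q\neq0\}$ is well-ordered (every nonempty subset has a least element), with the usual addition and product. $\mathbb{R}((\hbar^{\mathbb{Q}}))$ is ordered by: $a>0$ iff $a\ne 0$ and $a_{q_0}>0$, where $q_0=\min\operatorname{supp}a$. $\mathbb{C}((\hbar^{\mathbb{Q}}))=\mathbb{R}((\hbar^{\mathbb{Q}}))+i\,\mathbb{R}((\hbar^{\mathbb{Q}}))$. $C^\infty(M)((\hbar^{\mathbb{Q}}))$ is the $\mathbb{C}((\hbar^{\mathbb{Q}}))$-vector space of such series with coefficients in the complex-valued smooth functions on $M$. The overbar denotes coefficientwise complex conjugation ($\hbar$ is real). A star product is an associative $\mathbb{C}((\hbar^{\mathbb{Q}}))$-bilinear product of the form $f*g=\sum_{k=0}^\infty C_k(f,g)\hbar^k$, where the $C_k$ are bidifferential operators (acting coefficientwise) mapping $C^\infty(M)\times C^\infty(M)$ to $C^\infty(M)$, with $C_0(f,g)=fg$, $C_k(1,f)=C_k(f,1)=0$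 for $k\ge1$, and $C_1(f,g)-C_1(g,f)=i\{f,g\}$, where $\{\cdot,\cdot\}$ is the Poisson bracket of $(M,\omega)$. A $\mathbb{C}((\hbar^{\mathbb{Q}}))$-linear functional $\rho:C^\infty(M)((\hbar^{\mathbb{Q}}))\to\mathbb{C}((\hbar^{\mathbb{Q}}))$ is positive if $\rho(\overline f*f)\ge0$ (in particular lies in $\mathbb{R}((\hbar^{\mathbb{Q}}))$) for all $f$; it is a state if moreover $\rho(1)=1$. The condition $\rho(\overline f*f)=0$ says that $f$ belongs to the Gel'fand ideal $\mathcal{J}_\rho$ of $\rho$. A state $\rho$ is called a Robertson–Schrödinger intelligent state for real elements $X_1,\dots,X_n$ if $\det(\frac12\rho(\delta X_j*\delta X_k+\delta X_k*\delta X_j))=\det(\frac{\hbar}{2}\rho(\{X_j,X_k\}_* ))$. *)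

theory Defs
  imports
    "HOL-Analysis.Derivative"
    "HOL-Library.Function_Algebras"
    "Jordan_Normal_Form.Determinant"
begin

section \<open>Formal series with rational exponents and well-ordered support\<close>

definition wo_set :: "rat set \<Rightarrow> bool" where
  "wo_set S \<longleftrightarrow> (\<forall>T\<subseteq>S. T \<noteq> {} \<longrightarrow> (\<exists>x\<in>T. \<forall>y\<in>T. x \<le> y))"

lemma wo_setD: "wo_set S \<Longrightarrow> T \<subseteq> S \<Longrightarrow> T \<noteq> {} \<Longrightarrow> \<exists>x\<in>T. \<forall>y\<in>T. x \<le> y"
  by (simp add: wo_set_def)

lemma wo_set_subset: "wo_set S \<Longrightarrow> T \<subseteq> S \<Longrightarrow> wo_set T"
  unfolding wo_set_def by (meson subset_trans)

lemma wo_set_empty [simp]: "wo_set {}"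
  by (auto simp: wo_set_def)

lemma wo_set_singleton [simp]: "wo_set {x}"
  by (auto simp: wo_set_def subset_singleton_iff)

lemma wo_set_Un:
  assumes "wo_set S" "wo_set T"
  shows "wo_set (S \<union> T)"
  unfolding wo_set_def
proof (intro allI impI)
  fix Z assume Z: "Z \<subseteq> S \<union> T" "Z \<noteq> {}"
  show "\<exists>x\<in>Z. \<forall>y\<in>Z. x \<le> y"
  proof (cases "Z \<inter> S = {} \<or> Z \<inter> T = {}")
    case True
    then have "Z \<subseteq> T \<or> Z \<subseteq> S" using Z by blast
    then show ?thesis using assms Z(2) wo_setD by blast
  next
    case False
    obtain x where x: "x \<in> Z \<inter> S" "\<forall>y\<in>Z \<inter> S. x \<le> y"
      using wo_setD[OF assms(1), of "Z \<inter> S"] False by blast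
    obtain x' where x': "x' \<in> Z \<inter> T" "\<forall>y\<in>Z \<inter> T. x' \<le> y"
      using wo_setD[OF assms(2), of "Z \<inter> T"] False by blast
    have "min x x' \<le> y" if "y \<in> Z" for y
    proof -
      have "y \<in> Z \<inter> S \<or> y \<in> Z \<inter> T" using that Z(1) by blast
      then show ?thesis using x(2) x'(2) by (auto simp: min_le_iff_disj)
    qed
    moreover have "min x x' \<in> Z" using x x' by (auto simp: min_def)
    ultimately show ?thesis by blast
  qed
qed

lemma wo_set_UN:
  assumes "finite I" "\<And>i. i \<in> I \<Longrightarrow> wo_set (S i)"
  shows "wo_set (\<Union>i\<in>I. S i)"
  using assms by (induction I rule: finite_induct) (auto intro: wo_set_Un)

lemma wo_set_nat: "wo_set (range (of_nat :: nat \<Rightarrow> rat))"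
  unfolding wo_set_def
proof (intro allI impI)
  fix T :: "rat set" assume T: "T \<subseteq> range of_nat" "T \<noteq> {}"
  define n where "n = (LEAST n. (of_nat n :: rat) \<in> T)"
  have "\<exists>n. (of_nat n :: rat) \<in> T" using T by blast
  then have "(of_nat n :: rat) \<in> T" unfolding n_def by (rule LeastI_ex)
  moreover have "(of_nat n :: rat) \<le> y" if y: "y \<in> T" for y
  proof -
    obtain k where k: "y = of_nat k" using T y by blast
    then have "n \<le> k" unfolding n_def using y by (intro Least_le) simp
    then show ?thesis using k by simp
  qed
  ultimately show "\<exists>x\<in>T. \<forall>y\<in>T. x \<le> y" by blast
qed

lemma wo_set_induct [consumes 2, case_names step]:
  assumes "wo_set S" "x \<in> S"
    and step: "\<And>x. x \<in> S \<Longrightarrow> (\<And>y. y \<in> S \<Longrightarrow> y < x \<Longrightarrow> P y) \<Longrightarrow> P x"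
  shows "P x"
proof (rule ccontr)
  assume "\<not> P x"
  then obtain z where "z \<in> {y \<in> S. \<not> P y}" "\<forall>y\<in>{y \<in> S. \<not> P y}. z \<le> y"
    using wo_setD[OF assms(1), of "{y \<in> S. \<not> P y}"] assms(2) by blast
  then show False using step[of z] by force
qed

lemma wo_set_plus:
  assumes S: "wo_set S" and T: "wo_set T"
  shows "wo_set {s + t | s t. s \<in> S \<and> t \<in> T}"
proof -
  have main: "\<exists>x\<in>Z. \<forall>y\<in>Z. x \<le> y"
    if "t0 \<in> T" "s0 \<in> S" "s0 + t0 \<in> Z" "Z \<subseteq> {s + t | s t. s \<in> S \<and> t \<in> T}"
      "\<forall>s\<in>S. \<forall>t\<in>T. s + t \<in> Z \<longrightarrow> s0 \<le> s" for t0 s0 Z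
    using T that
  proof (induction t0 arbitrary: s0 Z rule: wo_set_induct)
    case (step t0)
    show ?case
    proof (cases "\<forall>y\<in>Z. s0 + t0 \<le> y")
      case True
      then show ?thesis using step by blast
    next
      case False
      define Z' where "Z' = {z \<in> Z. z < s0 + t0}"
      have Z'ne: "Z' \<noteq> {}" using False by (force simp: Z'_def)
      then have ne: "{s \<in> S. \<exists>t\<in>T. s + t \<in> Z'} \<noteq> {}"
        using step.prems(3) unfolding Z'_def by blast
      obtain s1 where s1: "s1 \<in> {s \<in> S. \<exists>t\<in>T. s + t \<in> Z'}"
        "\<forall>s\<in>{s \<in> S. \<exists>t\<in>T. s + t \<in> Z'}. s1 \<le> s"
        using wo_setD[OF S _ ne] by auto
      then obtain t1 where t1: "t1 \<in> T" "s1 + t1 \<in> Z'" by blast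
      have "s0 \<le> s1" using step.prems(4) s1(1) t1 unfolding Z'_def by blast
      then have "t1 < t0" using t1 unfolding Z'_def by force
      then obtain x where x: "x \<in> Z'" "\<forall>y\<in>Z'. x \<le> y"
        using step.IH[of t1 s1 Z'] t1 s1 step.prems(3) unfolding Z'_def by blast
      have "x \<le> y" if "y \<in> Z" for y
      proof (cases "y < s0 + t0")
        case True then show ?thesis using x that unfolding Z'_def by blast
      next
        case False then show ?thesis using x(1) unfolding Z'_def by auto
      qed
      then show ?thesis using x(1) unfolding Z'_def by blast
    qed
  qed
  show ?thesis unfolding wo_set_def
  proof (intro allI impI)
    fix Z assume Z: "Z \<subseteq> {s + t | s t. s \<in> S \<and> t \<in> T}" "Z \<noteq> {}"
    then have ne: "{s \<in> S. \<exists>t\<in>T. s + t \<in> Z} \<noteq> {}" by blast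
    obtain s0 where s0: "s0 \<in> {s \<in> S. \<exists>t\<in>T. s + t \<in> Z}"
      "\<forall>s\<in>{s \<in> S. \<exists>t\<in>T. s + t \<in> Z}. s0 \<le> s"
      using wo_setD[OF S _ ne] by auto
    then show "\<exists>x\<in>Z. \<forall>y\<in>Z. x \<le> y" using main[of _ s0 Z] Z(1) by blast
  qed
qed

lemma finite_of_wo_both:
  assumes "wo_set F" "wo_set (uminus ` F)"
  shows "finite F"
proof (rule ccontr)
  assume inf: "infinite F"
  define G where "G = {x \<in> F. finite {y \<in> F. y < x}}"
  have "F \<noteq> {}" using inf by auto
  then obtain m where m: "m \<in> F" "\<forall>y\<in>F. m \<le> y"
    using wo_setD[OF assms(1)] by blast
  then have "{y \<in> F. y < m} = {}" by auto
  then have "m \<in> G" using m(1) by (simp add: G_def del: Collect_empty_eq)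
  moreover have "uminus ` G \<subseteq> uminus ` F" by (auto simp: G_def)
  ultimately obtain g' where g': "g' \<in> uminus ` G" "\<forall>y\<in>uminus ` G. g' \<le> y"
    using wo_setD[OF assms(2), of "uminus ` G"] by blast
  then obtain g where g: "g \<in> G" "\<forall>y\<in>G. y \<le> g" by force
  have fin: "finite {y \<in> F. y \<le> g}"
    by (rule finite_subset[of _ "insert g {y \<in> F. y < g}"]) (use g(1) in \<open>auto simp: G_def\<close>)
  have "{y \<in> F. g < y} \<noteq> {}"
  proof
    assume "{y \<in> F. g < y} = {}"
    then have "F \<subseteq> {y \<in> F. y \<le> g}" by force
    then show False using fin inf finite_subset by blast
  qed
  then obtain h where h: "h \<in> {y \<in> F. g < y}" "\<forall>y\<in>{y \<in> F. g < y}. h \<le> y"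
    using wo_setD[OF assms(1), of "{y \<in> F. g < y}"] by blast
  have "{y \<in> F. y < h} \<subseteq> {y \<in> F. y \<le> g}" using h(2) by force
  then have "h \<in> G" using h(1) fin finite_subset unfolding G_def by blast
  then show False using g(2) h(1) by force
qed

lemma finite_fibre:
  assumes S: "wo_set S" and T: "wo_set T"
  shows "finite {r \<in> S. q - r \<in> T}"
proof (rule finite_of_wo_both)
  show "wo_set {r \<in> S. q - r \<in> T}" by (rule wo_set_subset[OF S]) auto
  have "wo_set {s + t | s t. s \<in> {- q} \<and> t \<in> T}" by (rule wo_set_plus[OF _ T]) simp
  then show "wo_set (uminus ` {r \<in> S. q - r \<in> T})"
    by (rule wo_set_subset) force
qed

typedef (overloaded) 'a hseries = "{a :: rat \<Rightarrow> 'a::zero. wo_set {q. a q \<noteq> 0}}"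
  morphisms hcoeff Abs_hseries
  by (rule exI[of _ "\<lambda>_. 0"]) simp

setup_lifting type_definition_hseries

definition hsupp :: "'a::zero hseries \<Rightarrow> rat set" where
  "hsupp a = {q. hcoeff a q \<noteq> 0}"

lemma wo_hsupp [simp]: "wo_set (hsupp a)"
  using hcoeff[of a] by (simp add: hsupp_def)

lemma hseries_eqI: "(\<And>q. hcoeff a q = hcoeff b q) \<Longrightarrow> a = b"
  by transfer auto

lemma hcoeff_Abs: "wo_set {q. f q \<noteq> 0} \<Longrightarrow> hcoeff (Abs_hseries f) = f"
  by (simp add: Abs_hseries_inverse)

lift_definition hmonom :: "rat \<Rightarrow> 'a::zero \<Rightarrow> 'a hseries" is "\<lambda>p c q. if q = p then c else 0"
  by (rule wo_set_subset[OF wo_set_singleton]) auto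

instantiation hseries :: (zero) zero
begin
lift_definition zero_hseries :: "'a hseries" is "\<lambda>_. 0" by simp
instance ..
end

instantiation hseries :: (zero_neq_one) one
begin
definition one_hseries :: "'a hseries" where "one_hseries = hmonom 0 1"
instance ..
end

instantiation hseries :: (ab_group_add) ab_group_add
begin

lift_definition plus_hseries :: "'a hseries \<Rightarrow> 'a hseries \<Rightarrow> 'a hseries" is "\<lambda>a b q. a q + b q"
  subgoal for a b
    by (rule wo_set_subset[of "{q. a q \<noteq> 0} \<union> {q. b q \<noteq> 0}"]) (auto intro: wo_set_Un)
  done

lift_definition uminus_hseries :: "'a hseries \<Rightarrow> 'a hseries" is "\<lambda>a q. - a q"
  by simp

lift_definition minus_hseries :: "'a hseries \<Rightarrow> 'a hseries \<Rightarrow> 'a hseries" is "\<lambda>a b q. a q - b q"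
  subgoal for a b
    by (rule wo_set_subset[of "{q. a q \<noteq> 0} \<union> {q. b q \<noteq> 0}"]) (auto intro: wo_set_Un)
  done

instance
  by standard (transfer, force simp: algebra_simps)+

end

lemma hcoeff_0 [simp]: "hcoeff 0 q = 0" by transfer simp
lemma hcoeff_add [simp]: "hcoeff (a + b) q = hcoeff a q + hcoeff b q" by transfer simp
lemma hcoeff_minus [simp]: "hcoeff (- a) q = - hcoeff a q" by transfer simp
lemma hcoeff_diff [simp]: "hcoeff (a - b) q = hcoeff a q - hcoeff b q" by transfer simp
lemma hcoeff_monom: "hcoeff (hmonom p c) q = (if q = p then c else 0)" by transfer simp
lemma hcoeff_1: "hcoeff 1 q = (if q = 0 then 1 else 0)" by (simp add: one_hseries_def hcoeff_monom)
lemma hcoeff_sum: "hcoeff (sum f I) q = (\<Sum>i\<in>I. hcoeff (f i) q)"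
  by (induction I rule: infinite_finite_induct) auto

lemma hseries_nonzero_iff: "a \<noteq> 0 \<longleftrightarrow> hsupp a \<noteq> {}"
  by (auto simp: hsupp_def intro: hseries_eqI)

text \<open>Cauchy product; the sum is finite by \<open>finite_fibre\<close>.\<close>
instantiation hseries :: (comm_ring_1) comm_ring_1
begin

lift_definition times_hseries :: "'a hseries \<Rightarrow> 'a hseries \<Rightarrow> 'a hseries" is
  "\<lambda>a b q. \<Sum>r | a r \<noteq> 0 \<and> b (q - r) \<noteq> 0. a r * b (q - r)"
  subgoal premises prems for a b
  proof (rule wo_set_subset[OF wo_set_plus[OF prems]], safe)
    fix q assume "(\<Sum>r | a r \<noteq> 0 \<and> b (q - r) \<noteq> 0. a r * b (q - r)) \<noteq> 0"
    then obtain r where "a r \<noteq> 0" "b (q - r) \<noteq> 0"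
      by (elim sum.not_neutral_contains_not_neutral) blast
    then show "\<exists>s t. q = s + t \<and> s \<in> {q. a q \<noteq> 0} \<and> t \<in> {q. b q \<noteq> 0}"
      by (intro exI[of _ r] exI[of _ "q - r"]) auto
  qed
  done

lemma hcoeff_mult_supset:
  fixes a b :: "'a hseries"
  assumes "wo_set S" "wo_set T" "hsupp a \<subseteq> S" "hsupp b \<subseteq> T"
  shows "hcoeff (a * b) q = (\<Sum>r\<in>{r\<in>S. q - r \<in> T}. hcoeff a r * hcoeff b (q - r))"
proof -
  have "hcoeff (a * b) q = (\<Sum>r | hcoeff a r \<noteq> 0 \<and> hcoeff b (q - r) \<noteq> 0. hcoeff a r * hcoeff b (q - r))"
    by transfer simp
  also have "\<dots> = (\<Sum>r\<in>{r\<in>S. q - r \<in> T}. hcoeff a r * hcoeff b (q - r))"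
    by (rule sum.mono_neutral_left[OF finite_fibre[OF assms(1,2)]])
      (use assms(3,4) in \<open>auto simp: hsupp_def\<close>)
  finally show ?thesis .
qed

lemma hcoeff_mult:
  "hcoeff (a * b :: 'a hseries) q =
    (\<Sum>r\<in>{r\<in>hsupp a. q - r \<in> hsupp b}. hcoeff a r * hcoeff b (q - r))"
  by (rule hcoeff_mult_supset[OF wo_hsupp wo_hsupp subset_refl subset_refl])

lemma hsupp_mult: "hsupp (a * b :: 'a hseries) \<subseteq> {s + t | s t. s \<in> hsupp a \<and> t \<in> hsupp b}"
proof
  fix q assume "q \<in> hsupp (a * b)"
  then have "(\<Sum>r\<in>{r\<in>hsupp a. q - r \<in> hsupp b}. hcoeff a r * hcoeff b (q - r)) \<noteq> 0"
    by (simp add: hsupp_def[of "a * b"] hcoeff_mult)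
  then obtain r where r: "r \<in> hsupp a" "q - r \<in> hsupp b"
    by (elim sum.not_neutral_contains_not_neutral) blast
  then show "q \<in> {s + t | s t. s \<in> hsupp a \<and> t \<in> hsupp b}"
    by (intro CollectI exI[of _ r] exI[of _ "q - r"]) auto
qed

instance
proof
  fix a b c :: "'a hseries"
  show "a * b = b * a"
  proof (rule hseries_eqI)
    fix q
    show "hcoeff (a * b) q = hcoeff (b * a) q"
      unfolding hcoeff_mult
      by (rule sum.reindex_bij_witness[of _ "\<lambda>r. q - r" "\<lambda>r. q - r"])
        (simp_all add: mult.commute)
  qed
  show "(a + b) * c = a * c + b * c"
  proof (rule hseries_eqI)
    fix q
    let ?S = "hsupp a \<union> hsupp b" and ?T = "hsupp c"
    have wo: "wo_set ?S" by (simp add: wo_set_Un)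
    have sub: "hsupp (a + b) \<subseteq> ?S" by (auto simp: hsupp_def)
    show "hcoeff ((a + b) * c) q = hcoeff (a * c + b * c) q"
      using hcoeff_mult_supset[OF wo wo_hsupp sub subset_refl]
        hcoeff_mult_supset[OF wo wo_hsupp _ subset_refl, of a c]
        hcoeff_mult_supset[OF wo wo_hsupp _ subset_refl, of b c]
      by (simp add: sum.distrib distrib_right)
  qed
  show "(1 :: 'a hseries) * a = a"
  proof (rule hseries_eqI)
    fix q
    have sub: "hsupp (1 :: 'a hseries) \<subseteq> {0}" by (auto simp: hsupp_def hcoeff_1)
    have "hcoeff (1 * a) q = (\<Sum>r\<in>{r\<in>{0}. q - r \<in> hsupp a}. hcoeff 1 r * hcoeff a (q - r))"
      by (rule hcoeff_mult_supset[OF _ _ sub]) auto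
    also have "\<dots> = (\<Sum>r\<in>{0}. hcoeff 1 r * hcoeff a (q - r))"
      by (rule sum.mono_neutral_left) (auto simp: hsupp_def)
    finally show "hcoeff (1 * a) q = hcoeff a q" by (simp add: hcoeff_1)
  qed
  show "(0 :: 'a hseries) \<noteq> 1"
  proof
    assume "(0 :: 'a hseries) = 1"
    then have "hcoeff (0 :: 'a hseries) 0 = hcoeff 1 0" by simp
    then show False by (simp add: hcoeff_1)
  qed
  show "a * b * c = a * (b * c)"
  proof (rule hseries_eqI)
    fix q
    let ?A = "hsupp a" and ?B = "hsupp b" and ?C = "hsupp c"
    let ?AB = "{s + t | s t. s \<in> ?A \<and> t \<in> ?B}" and ?BC = "{s + t | s t. s \<in> ?B \<and> t \<in> ?C}"
    have wo: "wo_set ?AB" "wo_set ?BC" by (auto intro: wo_set_plus)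
    have "hcoeff (a * b * c) q
        = (\<Sum>r\<in>{r\<in>?AB. q - r \<in> ?C}. hcoeff (a * b) r * hcoeff c (q - r))"
      by (rule hcoeff_mult_supset[OF wo(1) wo_hsupp hsupp_mult subset_refl])
    also have "\<dots> = (\<Sum>r\<in>{r\<in>?AB. q - r \<in> ?C}. \<Sum>s\<in>{s\<in>?A. r - s \<in> ?B}.
        hcoeff a s * hcoeff b (r - s) * hcoeff c (q - r))"
      by (simp add: hcoeff_mult sum_distrib_right)
    also have "\<dots> = (\<Sum>(r, s)\<in>Sigma {r\<in>?AB. q - r \<in> ?C} (\<lambda>r. {s\<in>?A. r - s \<in> ?B}).
        hcoeff a s * hcoeff b (r - s) * hcoeff c (q - r))"
      by (rule sum.Sigma) ((intro ballI)?; rule finite_fibre; simp add: wo)+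
    also have "\<dots> = (\<Sum>(s, t)\<in>Sigma {s\<in>?A. q - s \<in> ?BC} (\<lambda>s. {t\<in>?B. q - s - t \<in> ?C}).
        hcoeff a s * (hcoeff b t * hcoeff c (q - s - t)))"
    proof (rule sum.reindex_bij_witness[of _ "\<lambda>(s, t). (s + t, s)" "\<lambda>(r, s). (s, r - s)"])
      fix p assume "p \<in> Sigma {r\<in>?AB. q - r \<in> ?C} (\<lambda>r. {s\<in>?A. r - s \<in> ?B})"
      then obtain r s where p: "p = (r, s)" "q - r \<in> ?C" "s \<in> ?A" "r - s \<in> ?B" by auto
      have "q - s = (r - s) + (q - r)" by simp
      then have "q - s \<in> ?BC" using p by blast
      then show "(case p of (r, s) \<Rightarrow> (s, r - s)) \<in> Sigma {s\<in>?A. q - s \<in> ?BC} (\<lambda>s. {t\<in>?B. q - s - t \<in> ?C})"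
        using p by (simp add: algebra_simps)
    next
      fix p assume "p \<in> Sigma {s\<in>?A. q - s \<in> ?BC} (\<lambda>s. {t\<in>?B. q - s - t \<in> ?C})"
      then obtain s t where "p = (s, t)" "s \<in> ?A" "t \<in> ?B" "q - s - t \<in> ?C" by auto
      then show "(case p of (s, t) \<Rightarrow> (s + t, s)) \<in> Sigma {r\<in>?AB. q - r \<in> ?C} (\<lambda>r. {s\<in>?A. r - s \<in> ?B})"
        by (auto simp: algebra_simps)
    qed (auto simp: algebra_simps)
    also have "\<dots> = (\<Sum>s\<in>{s\<in>?A. q - s \<in> ?BC}. \<Sum>t\<in>{t\<in>?B. q - s - t \<in> ?C}.
        hcoeff a s * (hcoeff b t * hcoeff c (q - s - t)))"
      by (rule sum.Sigma[symmetric]) ((intro ballI)?; rule finite_fibre; simp add: wo)+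
    also have "\<dots> = (\<Sum>s\<in>{s\<in>?A. q - s \<in> ?BC}. hcoeff a s * hcoeff (b * c) (q - s))"
      by (simp add: hcoeff_mult sum_distrib_left)
    also have "\<dots> = hcoeff (a * (b * c)) q"
      by (rule hcoeff_mult_supset[OF wo_hsupp wo(2) subset_refl hsupp_mult, symmetric])
    finally show "hcoeff (a * b * c) q = hcoeff (a * (b * c)) q" .
  qed
qed

end

text \<open>The exponent of the leading term, $\min\operatorname{supp} a$ (for $a \neq 0$).\<close>
definition hval :: "'a::zero hseries \<Rightarrow> rat" where
  "hval a = (LEAST q. hcoeff a q \<noteq> 0)"

definition hlead :: "'a::zero hseries \<Rightarrow> 'a" where
  "hlead a = hcoeff a (hval a)"

lemma
  fixes a :: "'a::ab_group_add hseries"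
  assumes "a \<noteq> 0"
  shows hlead_nonzero: "hlead a \<noteq> 0"
    and hval_le: "\<And>q. hcoeff a q \<noteq> 0 \<Longrightarrow> hval a \<le> q"
proof -
  obtain x where x: "x \<in> hsupp a" "\<forall>y\<in>hsupp a. x \<le> y"
    using wo_setD[OF wo_hsupp subset_refl, of a] assms hseries_nonzero_iff by blast
  have "hval a = x" unfolding hval_def
    by (rule Least_equality) (use x in \<open>auto simp: hsupp_def\<close>)
  then show "hlead a \<noteq> 0" "\<And>q. hcoeff a q \<noteq> 0 \<Longrightarrow> hval a \<le> q"
    using x by (auto simp: hlead_def hsupp_def)
qed

lemma hval_eqI:
  assumes "hcoeff a p \<noteq> 0" "\<And>q. q < p \<Longrightarrow> hcoeff a q = 0"
  shows "hval a = p"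
  unfolding hval_def by (rule Least_equality) (use assms in force)+

lemma hcoeff_below_hval: 
  fixes a :: "'a::ab_group_add hseries"
  shows "q < hval a \<Longrightarrow> hcoeff a q = 0"
  by (cases "a = 0") (use hval_le in force)+

lemma hcoeff_mult_below:
  fixes a b :: "'a::comm_ring_1 hseries"
  assumes "\<And>r. r < s \<Longrightarrow> hcoeff a r = 0" "\<And>r. r < t \<Longrightarrow> hcoeff b r = 0"
  shows "q < s + t \<Longrightarrow> hcoeff (a * b) q = 0"
    and "hcoeff (a * b) (s + t) = hcoeff a s * hcoeff b t"
proof -
  have a: "s \<le> r" if "r \<in> hsupp a" for r using that assms(1) by (force simp: hsupp_def)
  have b: "t \<le> r" if "r \<in> hsupp b" for r using that assms(2) by (force simp: hsupp_def)
  show "hcoeff (a * b) q = 0" if "q < s + t"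
  proof (rule ccontr)
    assume "hcoeff (a * b) q \<noteq> 0"
    then have "q \<in> hsupp (a * b)" by (simp add: hsupp_def)
    then show False using hsupp_mult[of a b] a b that by force
  qed
  have "hcoeff (a * b) (s + t)
      = (\<Sum>r\<in>{r\<in>hsupp a. s + t - r \<in> hsupp b}. hcoeff a r * hcoeff b (s + t - r))"
    by (rule hcoeff_mult)
  also have "\<dots> = (\<Sum>r\<in>{s}. hcoeff a r * hcoeff b (s + t - r))"
  proof (rule sum.mono_neutral_left)
    show "{r \<in> hsupp a. s + t - r \<in> hsupp b} \<subseteq> {s}" using a b by force
  qed (auto simp: hsupp_def)
  finally show "hcoeff (a * b) (s + t) = hcoeff a s * hcoeff b t" by simp
qed

lemma
  fixes a b :: "'a::idom hseries"
  assumes "a \<noteq> 0" "b \<noteq> 0"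
  shows hval_mult: "hval (a * b) = hval a + hval b"
    and hlead_mult: "hlead (a * b) = hlead a * hlead b"
    and hseries_no_zero_divisors: "a * b \<noteq> 0"
proof -
  note below = hcoeff_mult_below[of "hval a" a "hval b" b, OF hcoeff_below_hval hcoeff_below_hval]
  have nz: "hcoeff (a * b) (hval a + hval b) \<noteq> 0"
    using below(2) hlead_nonzero assms by (auto simp: hlead_def)
  then show "a * b \<noteq> 0" by auto
  show "hval (a * b) = hval a + hval b"
    by (rule hval_eqI[OF nz]) (use below(1) in blast)
  then show "hlead (a * b) = hlead a * hlead b"
    using below(2) by (simp add: hlead_def)
qed

instance hseries :: (idom) idom
  by standard (use hseries_no_zero_divisors in blast)

subsection \<open>Inverses\<close>

lemma hseries_geometric:
  fixes e :: "'a::comm_ring_1 hseries"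
  assumes "\<And>q. q \<le> 0 \<Longrightarrow> hcoeff e q = 0"
  shows "\<exists>g. (1 - e) * g = 1"
proof (cases "e = 0")
  case True
  then show ?thesis by (intro exI[of _ 1]) simp
next
  case False
  define s where "s = hval e"
  have s: "s > 0" using hlead_nonzero[OF False] assms[of s] unfolding hlead_def s_def by force
  have pow: "hcoeff (e ^ n) q = 0" if "q < of_nat n * s" for n q
    using that
  proof (induction n arbitrary: q)
    case 0
    then show ?case by (simp add: hcoeff_1)
  next
    case (Suc n)
    have "hcoeff (e * e ^ n) q = 0"
      by (rule hcoeff_mult_below(1)[of s _ "of_nat n * s"])
        (use Suc hcoeff_below_hval in \<open>auto simp: s_def algebra_simps\<close>)
    then show ?case by simp
  qed
  define N where "N q = nat \<lceil>q / s\<rceil>" for q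
  have N: "q < of_nat n * s" if "N q < n" for q n
  proof -
    have "q / s \<le> of_int \<lceil>q / s\<rceil>" by simp
    also have "\<dots> \<le> of_nat (N q)" unfolding N_def
      by (metis of_int_le_iff of_int_of_nat_eq int_nat_eq linear order_refl of_nat_nat nat_le_0 of_nat_0_le_iff)
    also have "\<dots> < of_nat n" using that by simp
    finally show ?thesis using s by (simp add: field_simps)
  qed
  define G where "G n = (\<Sum>i\<le>n. e ^ i)" for n
  have tele: "(1 - e) * G n = 1 - e ^ Suc n" for n
    unfolding G_def by (simp add: sum_gp_basic)
  define g where "g q = hcoeff (G (N q)) q" for q
  have gG: "g q = hcoeff (G n) q" if "N q \<le> n" for q n
  proof -
    have "hcoeff (G n) q = (\<Sum>i\<le>n. hcoeff (e ^ i) q)" by (simp add: G_def hcoeff_sum)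
    also have "\<dots> = (\<Sum>i\<le>N q. hcoeff (e ^ i) q)"
      by (rule sum.mono_neutral_right) (use that pow N in auto)
    finally show ?thesis by (simp add: g_def G_def hcoeff_sum)
  qed
  have Nmono: "N q \<le> N q'" if "q \<le> q'" for q q'
    unfolding N_def using that s by (intro nat_mono ceiling_mono divide_right_mono) auto
  have wo: "wo_set {q. g q \<noteq> 0}" unfolding wo_set_def
  proof (intro allI impI)
    fix Z assume Z: "Z \<subseteq> {q. g q \<noteq> 0}" "Z \<noteq> {}"
    then obtain z where z: "z \<in> Z" by blast
    have "{q \<in> Z. q \<le> z} \<subseteq> hsupp (G (N z))"
    proof safe
      fix q assume q: "q \<in> Z" "q \<le> z"
      then have "g q \<noteq> 0" using Z by blast
      then show "q \<in> hsupp (G (N z))" using gG[OF Nmono[OF q(2)]] by (simp add: hsupp_def)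
    qed
    then obtain x where "x \<in> {q \<in> Z. q \<le> z}" "\<forall>y\<in>{q \<in> Z. q \<le> z}. x \<le> y"
      using wo_setD[OF wo_hsupp, of "{q \<in> Z. q \<le> z}"] z by blast
    then show "\<exists>x\<in>Z. \<forall>y\<in>Z. x \<le> y" by (intro bexI[of _ x]) force+
  qed
  define h where "h = Abs_hseries g"
  have h: "hcoeff h = g" unfolding h_def by (rule hcoeff_Abs[OF wo])
  have "(1 - e) * h = 1"
  proof (rule hseries_eqI)
    fix q
    let ?S = "hsupp (1 - e)" and ?T = "hsupp h \<union> hsupp (G (N q))"
    have nonneg: "r \<ge> 0" if "r \<in> ?S" for r
      using that assms[of r] by (cases "r \<le> 0") (auto simp: hsupp_def hcoeff_1 split: if_splits)
    have T: "wo_set ?T" by (simp add: wo_set_Un)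
    have "hcoeff ((1 - e) * h) q = (\<Sum>r\<in>{r\<in>?S. q - r \<in> ?T}. hcoeff (1 - e) r * hcoeff h (q - r))"
      by (rule hcoeff_mult_supset[OF _ T]) auto
    also have "\<dots> = (\<Sum>r\<in>{r\<in>?S. q - r \<in> ?T}. hcoeff (1 - e) r * hcoeff (G (N q)) (q - r))"
    proof (intro sum.cong refl)
      fix r assume "r \<in> {r\<in>?S. q - r \<in> ?T}"
      then have "N (q - r) \<le> N q" using nonneg by (intro Nmono) auto
      then show "hcoeff (1 - e) r * hcoeff h (q - r) = hcoeff (1 - e) r * hcoeff (G (N q)) (q - r)"
        by (simp add: h gG)
    qed
    also have "\<dots> = hcoeff ((1 - e) * G (N q)) q"
      by (rule hcoeff_mult_supset[OF _ T, symmetric]) auto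
    also have "\<dots> = hcoeff 1 q" using pow[OF N[of q "Suc (N q)"]] by (simp add: tele)
    finally show "hcoeff ((1 - e) * h) q = hcoeff 1 q" .
  qed
  then show ?thesis by blast
qed

lemma hmonom_mult: "hmonom p c * hmonom q d = hmonom (p + q) (c * d :: 'a::comm_ring_1)"
proof (rule hseries_eqI)
  fix r
  have "hcoeff (hmonom p c * hmonom q d) r
    = (\<Sum>x\<in>{x\<in>{p}. r - x \<in> {q}}. hcoeff (hmonom p c) x * hcoeff (hmonom q d) (r - x))"
    by (rule hcoeff_mult_supset) (auto simp: hsupp_def hcoeff_monom split: if_splits)
  also have "\<dots> = hcoeff (hmonom (p + q) (c * d)) r"
  proof (cases "r = p + q")
    case True
    then have "{x\<in>{p}. r - x \<in> {q}} = {p}" by auto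
    then show ?thesis using True by (simp add: hcoeff_monom)
  next
    case False
    then have empty: "{x\<in>{p}. r - x \<in> {q}} = {}" by auto
    show ?thesis unfolding empty using False by (simp add: hcoeff_monom)
  qed
  finally show "hcoeff (hmonom p c * hmonom q d) r = hcoeff (hmonom (p + q) (c * d)) r" .
qed

lemma hseries_inverse_exists:
  fixes a :: "'a::field hseries"
  assumes "a \<noteq> 0"
  shows "\<exists>b. a * b = 1"
proof -
  define m where "m = hmonom (- hval a) (1 / hlead a)"
  have m: "hcoeff m r = 0" if "r < - hval a" for r using that by (simp add: m_def hcoeff_monom)
  note below = hcoeff_mult_below[of "hval a" a "- hval a" m, OF hcoeff_below_hval m]
  have c0: "hcoeff (a * m) 0 = 1"
    using below(2) hlead_nonzero[OF assms] by (simp add: m_def hcoeff_monom hlead_def)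
  have "\<exists>g. (1 - (1 - a * m)) * g = 1"
  proof (rule hseries_geometric)
    fix q :: rat assume "q \<le> 0"
    then show "hcoeff (1 - a * m) q = 0"
      using below(1)[of q] c0 by (cases "q = 0") (auto simp: hcoeff_1)
  qed
  then show ?thesis by (auto simp: mult.assoc)
qed

instantiation hseries :: (field) field
begin

definition inverse_hseries :: "'a hseries \<Rightarrow> 'a hseries" where
  "inverse_hseries a = (if a = 0 then 0 else (SOME b. a * b = 1))"

definition divide_hseries :: "'a hseries \<Rightarrow> 'a hseries \<Rightarrow> 'a hseries" where
  "divide_hseries a b = a * inverse b"

instance
proof
  fix a b :: "'a hseries"
  show "a div b = a * inverse b" by (simp add: divide_hseries_def)
  show "inverse (0 :: 'a hseries) = 0" by (simp add: inverse_hseries_def)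
  assume "a \<noteq> 0"
  then show "inverse a * a = 1"
    using someI_ex[OF hseries_inverse_exists, of a] by (simp add: inverse_hseries_def mult.commute)
qed

end

subsection \<open>Order\<close>

instantiation hseries :: (linordered_field) linordered_field
begin

definition less_hseries :: "'a hseries \<Rightarrow> 'a hseries \<Rightarrow> bool" where
  "a < b \<longleftrightarrow> b - a \<noteq> 0 \<and> hlead (b - a) > 0"

definition less_eq_hseries :: "'a hseries \<Rightarrow> 'a hseries \<Rightarrow> bool" where
  "(a :: 'a hseries) \<le> b \<longleftrightarrow> a = b \<or> a < b"

definition abs_hseries :: "'a hseries \<Rightarrow> 'a hseries" where
  "abs_hseries (a :: 'a hseries) = (if a < 0 then - a else a)"

definition sgn_hseries :: "'a hseries \<Rightarrow> 'a hseries" where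
  "sgn_hseries a = (if a = 0 then 0 else if 0 < a then 1 else - 1)"

lemma hseries_pos_iff: "0 < (a :: 'a hseries) \<longleftrightarrow> a \<noteq> 0 \<and> hcoeff a (hval a) > 0"
  by (simp add: less_hseries_def hlead_def)

instance
proof
  fix a b c :: "'a hseries"
  have neg: "hlead (- x) = - hlead x" for x :: "'a hseries"
    by (simp add: hlead_def hval_def)
  have pos_add: "x + y \<noteq> 0 \<and> hlead (x + y) > 0"
    if "x \<noteq> 0" "hlead x > 0" "y \<noteq> 0" "hlead y > 0" for x y :: "'a hseries"
  proof -
    define p where "p = min (hval x) (hval y)"
    have "hcoeff (x + y) p > 0"
    proof (cases "hval x" "hval y" rule: linorder_cases)
      case less
      then show ?thesis using that hcoeff_below_hval[of "hval x" y] by (simp add: p_def hlead_def)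
    next
      case equal
      then show ?thesis using that by (simp add: p_def hlead_def)
    next
      case greater
      then show ?thesis using that hcoeff_below_hval[of "hval y" x] by (simp add: p_def hlead_def)
    qed
    moreover have "hcoeff (x + y) q = 0" if "q < p" for q
      using that hcoeff_below_hval[of q x] hcoeff_below_hval[of q y] by (simp add: p_def)
    ultimately have "hval (x + y) = p" "hcoeff (x + y) p > 0"
      by (auto intro: hval_eqI)
    then show ?thesis by (metis hcoeff_0 hlead_def less_irrefl)
  qed
  have trans: "x < z" if "x < y" "y < z" for x y z :: "'a hseries"
    using pos_add[of "z - y" "y - x"] that by (simp add: less_hseries_def)
  have asym: "\<not> y < x" if "x < y" for x y :: "'a hseries"
    using that neg[of "y - x"] by (simp add: less_hseries_def)
  show "(a < b) = (a \<le> b \<and> \<not> b \<le> a)"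
    using asym by (auto simp: less_eq_hseries_def less_hseries_def)
  show "a \<le> a" by (simp add: less_eq_hseries_def)
  show "a \<le> b \<Longrightarrow> b \<le> c \<Longrightarrow> a \<le> c" using trans by (auto simp: less_eq_hseries_def)
  show "a \<le> b \<Longrightarrow> b \<le> a \<Longrightarrow> a = b" using asym by (auto simp: less_eq_hseries_def)
  show "a \<le> b \<or> b \<le> a"
    using hlead_nonzero[of "b - a"] neg[of "b - a"]
    by (auto simp: less_eq_hseries_def less_hseries_def)
  show "a \<le> b \<Longrightarrow> c + a \<le> c + b"
    by (auto simp: less_eq_hseries_def less_hseries_def)
  show "a < b \<Longrightarrow> 0 < c \<Longrightarrow> c * a < c * b"
  proof -
    assume "a < b" "0 < c"
    then have "b - a \<noteq> 0" "hlead (b - a) > 0" "c \<noteq> 0" "hlead c > 0"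
      by (simp_all add: less_hseries_def)
    then have "c * (b - a) \<noteq> 0 \<and> hlead (c * (b - a)) > 0"
      by (simp add: hlead_mult)
    then show "c * a < c * b" by (simp add: less_hseries_def algebra_simps)
  qed
  show "\<bar>a\<bar> = (if a < 0 then - a else a)" by (simp add: abs_hseries_def)
  show "sgn a = (if a = 0 then 0 else if 0 < a then 1 else - 1)" by (simp add: sgn_hseries_def)
qed

end


subsection \<open>Complex series and series of functions\<close>

text \<open>Pointwise operations make \<open>'p \<Rightarrow> complex\<close> a commutative ring, so that
  \<open>('p \<Rightarrow> complex) hseries\<close> carries the undeformed product, used here only to
  multiply by scalars.\<close>

lift_definition hreal :: "real hseries \<Rightarrow> complex hseries" is "\<lambda>a q. complex_of_real (a q)"
  by simp

lift_definition hcnj :: "complex hseries \<Rightarrow> complex hseries" is "\<lambda>a q. cnj (a q)"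
  by simp

lift_definition fcnj :: "('p \<Rightarrow> complex) hseries \<Rightarrow> ('p \<Rightarrow> complex) hseries"
  is "\<lambda>f q p. cnj (f q p)"
  by (erule wo_set_subset) (auto simp: fun_eq_iff)

lift_definition scalar :: "complex hseries \<Rightarrow> ('p \<Rightarrow> complex) hseries" is "\<lambda>a q p. a q"
  by (erule wo_set_subset) (auto simp: fun_eq_iff)

definition hscale :: "complex hseries \<Rightarrow> ('p \<Rightarrow> complex) hseries \<Rightarrow> ('p \<Rightarrow> complex) hseries"
    (infixr \<open>*\<^sub>h\<close> 75) where
  "a *\<^sub>h f = scalar a * f"

definition hbar :: "complex hseries" where "hbar = hmonom 1 1"

definition himag :: "complex hseries" where "himag = hmonom 0 \<i>"

definition hnonneg :: "complex hseries \<Rightarrow> bool" where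
  "hnonneg z \<longleftrightarrow> (\<exists>r. 0 \<le> r \<and> z = hreal r)"


section \<open>Symplectic manifolds\<close>

text \<open>For open \<open>S\<close> in a finite-dimensional space.\<close>
primrec Ck_on :: "nat \<Rightarrow> ('e::real_normed_vector \<Rightarrow> 'f::real_normed_vector) \<Rightarrow> 'e set \<Rightarrow> bool" where
  "Ck_on 0 f S \<longleftrightarrow> continuous_on S f"
| "Ck_on (Suc k) f S \<longleftrightarrow>
    f differentiable_on S \<and> (\<forall>v. Ck_on k (\<lambda>x. frechet_derivative f (at x) v) S)"

definition smooth_on :: "('e::real_normed_vector \<Rightarrow> 'f::real_normed_vector) \<Rightarrow> 'e set \<Rightarrow> bool" where
  "smooth_on f S \<longleftrightarrow> (\<forall>k. Ck_on k f S)"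

type_synonym ('p, 'e) chart = "'p set \<times> ('p \<Rightarrow> 'e)"

text \<open>The manifold is the whole type \<open>'p\<close>. The model space is any finite-dimensional
  normed space rather than a \<^class>\<open>euclidean_space\<close>, because the latter excludes dimension 0.\<close>
definition smooth_atlas ::
  "('p::{t2_space, second_countable_topology}, 'e::real_normed_vector) chart set \<Rightarrow> bool" where
  "smooth_atlas A \<longleftrightarrow>
    (\<exists>B. finite B \<and> span B = (UNIV :: 'e set)) \<and>
    (\<Union>(U, \<phi>)\<in>A. U) = UNIV \<and>
    (\<forall>(U, \<phi>)\<in>A. open U \<and> open (\<phi> ` U) \<and> homeomorphism U (\<phi> ` U) \<phi> (inv_into U \<phi>)) \<and>
    (\<forall>(U, \<phi>)\<in>A. \<forall>(V, \<psi>)\<in>A. smooth_on (\<psi> \<circ> inv_into U \<phi>) (\<phi> ` (U \<inter> V)))"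

definition smooth_funs ::
  "('p, 'e::real_normed_vector) chart set \<Rightarrow> ('p \<Rightarrow> complex) set" where
  "smooth_funs A = {f. \<forall>(U, \<phi>)\<in>A. smooth_on (f \<circ> inv_into U \<phi>) (\<phi> ` U)}"

text \<open>A 2-form is given by its local representatives: \<open>\<omega> c x\<close> is the bilinear form on the
  model space that represents the form at the point with coordinates \<open>x\<close> in the chart \<open>c\<close>.
  The clauses say: bilinear, alternating and nondegenerate; smooth; closed (the formula for
  \<open>d\<omega>\<close> evaluated on constant vector fields); compatible under changes of charts.\<close>
definition symplectic_form ::
  "('p, 'e::real_normed_vector) chart set \<Rightarrow> (('p, 'e) chart \<Rightarrow> 'e \<Rightarrow> 'e \<Rightarrow> 'e \<Rightarrow> real) \<Rightarrow> bool" where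
  "symplectic_form A \<omega> \<longleftrightarrow>
    (\<forall>(U, \<phi>)\<in>A. \<forall>x\<in>\<phi> ` U.
      bilinear (\<omega> (U, \<phi>) x) \<and>
      (\<forall>v. \<omega> (U, \<phi>) x v v = 0) \<and>
      (\<forall>v. (\<forall>w. \<omega> (U, \<phi>) x v w = 0) \<longrightarrow> v = 0)) \<and>
    (\<forall>(U, \<phi>)\<in>A. \<forall>v w. smooth_on (\<lambda>x. \<omega> (U, \<phi>) x v w) (\<phi> ` U)) \<and>
    (\<forall>(U, \<phi>)\<in>A. \<forall>x\<in>\<phi> ` U. \<forall>u v w.
      frechet_derivative (\<lambda>y. \<omega> (U, \<phi>) y v w) (at x) u
      + frechet_derivative (\<lambda>y. \<omega> (U, \<phi>) y w u) (at x) v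
      + frechet_derivative (\<lambda>y. \<omega> (U, \<phi>) y u v) (at x) w = 0) \<and>
    (\<forall>(U, \<phi>)\<in>A. \<forall>(V, \<psi>)\<in>A. \<forall>x\<in>\<phi> ` (U \<inter> V). \<forall>v w.
      (let \<tau> = \<psi> \<circ> inv_into U \<phi>; D\<tau> = frechet_derivative \<tau> (at x)
       in \<omega> (V, \<psi>) (\<tau> x) (D\<tau> v) (D\<tau> w) = \<omega> (U, \<phi>) x v w))"

text \<open>Sign conventions: $\omega(X_F, \cdot) = dF$ and $\{F, G\} = \omega(X_F, X_G)$, so that
  $\{q, p\} = 1$ for $\omega = dq \wedge dp$.\<close>
definition hamiltonian_vector :: "('e \<Rightarrow> 'e \<Rightarrow> real) \<Rightarrow> ('e \<Rightarrow> real) \<Rightarrow> 'e::real_normed_vector \<Rightarrow> 'e" where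
  "hamiltonian_vector \<Omega> F x = (THE v. \<forall>w. \<Omega> v w = frechet_derivative F (at x) w)"

definition local_bracket ::
  "('e \<Rightarrow> 'e \<Rightarrow> 'e \<Rightarrow> real) \<Rightarrow> ('e \<Rightarrow> real) \<Rightarrow> ('e \<Rightarrow> real) \<Rightarrow> 'e::real_normed_vector \<Rightarrow> real" where
  "local_bracket \<Omega> F G x =
    \<Omega> x (hamiltonian_vector (\<Omega> x) F x) (hamiltonian_vector (\<Omega> x) G x)"

text \<open>The value at \<open>p\<close> does not depend on the chart \<open>c\<close> around \<open>p\<close>. The bracket of real
  functions is extended complex-bilinearly.\<close>
definition poisson_bracket ::
  "('p, 'e::real_normed_vector) chart set \<Rightarrow> (('p, 'e) chart \<Rightarrow> 'e \<Rightarrow> 'e \<Rightarrow> 'e \<Rightarrow> real) \<Rightarrow>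
    ('p \<Rightarrow> complex) \<Rightarrow> ('p \<Rightarrow> complex) \<Rightarrow> 'p \<Rightarrow> complex" where
  "poisson_bracket A \<omega> f g p =
    (let c = (SOME c. c \<in> A \<and> p \<in> fst c);
         \<phi>inv = inv_into (fst c) (snd c);
         b = (\<lambda>h k. complex_of_real (local_bracket (\<omega> c) (h \<circ> \<phi>inv) (k \<circ> \<phi>inv) (snd c p)))
     in b (Re \<circ> f) (Re \<circ> g) - b (Im \<circ> f) (Im \<circ> g)
        + \<i> * (b (Re \<circ> f) (Im \<circ> g) + b (Im \<circ> f) (Re \<circ> g)))"


section \<open>Star products\<close>

definition smooth_series :: "('p, 'e::real_normed_vector) chart set \<Rightarrow> ('p \<Rightarrow> complex) hseries set" where
  "smooth_series A = {f. \<forall>q. hcoeff f q \<in> smooth_funs A}"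

text \<open>Iterated directional derivative along a list of vectors.\<close>
primrec partials :: "'e list \<Rightarrow> ('e::real_normed_vector \<Rightarrow> complex) \<Rightarrow> 'e \<Rightarrow> complex" where
  "partials [] F = F"
| "partials (v # vs) F = (\<lambda>x. frechet_derivative (partials vs F) (at x) v)"

text \<open>Lists of basis vectors of length at most \<open>N\<close> play the role of multi-indices of order at
  most \<open>N\<close>; since partial derivatives commute, listing a multi-index several times does not
  change the class of operators.\<close>
definition bidifferential ::
  "('p, 'e::real_normed_vector) chart set \<Rightarrow>
    (('p \<Rightarrow> complex) \<Rightarrow> ('p \<Rightarrow> complex) \<Rightarrow> 'p \<Rightarrow> complex) \<Rightarrow> bool" where
  "bidifferential A C \<longleftrightarrow>
    (\<forall>f\<in>smooth_funs A. \<forall>g\<in>smooth_funs A. C f g \<in> smooth_funs A) \<and>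
    (\<exists>B N. finite B \<and> independent B \<and> span B = UNIV \<and>
      (\<forall>(U, \<phi>)\<in>A. \<exists>a. (\<forall>I J. smooth_on (a I J :: 'e \<Rightarrow> complex) (\<phi> ` U)) \<and>
        (\<forall>f\<in>smooth_funs A. \<forall>g\<in>smooth_funs A. \<forall>p\<in>U.
          C f g p =
            (\<Sum>I\<in>{I. set I \<subseteq> B \<and> length I \<le> N}. \<Sum>J\<in>{J. set J \<subseteq> B \<and> length J \<le> N}.
              a I J (\<phi> p) * partials I (f \<circ> inv_into U \<phi>) (\<phi> p)
                          * partials J (g \<circ> inv_into U \<phi>) (\<phi> p)))))"

lemma finite_star_index:
  fixes f g :: "'a::zero hseries"
  shows "finite {(k, q, r). q \<in> hsupp f \<and> r \<in> hsupp g \<and> q + r + of_nat k = s}"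
proof -
  let ?N = "range (of_nat :: nat \<Rightarrow> rat)"
  let ?T = "{r + n | r n. r \<in> hsupp g \<and> n \<in> ?N}"
  have T: "wo_set ?T" by (rule wo_set_plus[OF wo_hsupp wo_set_nat])
  let ?I = "Sigma {q \<in> hsupp f. s - q \<in> ?T} (\<lambda>q. {r \<in> hsupp g. s - q - r \<in> ?N})"
  have fin: "finite ?I"
    by (intro finite_SigmaI finite_fibre[OF wo_hsupp T] finite_fibre[OF wo_hsupp wo_set_nat])
  have "{(k, q, r). q \<in> hsupp f \<and> r \<in> hsupp g \<and> q + r + of_nat k = s}
    \<subseteq> (\<lambda>(q, r). (nat \<lfloor>s - q - r\<rfloor>, q, r)) ` ?I"
  proof (rule subsetI)
    fix x assume "x \<in> {(k, q, r). q \<in> hsupp f \<and> r \<in> hsupp g \<and> q + r + of_nat k = s}"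
    then obtain k q r where x: "x = (k, q, r)" "q \<in> hsupp f" "r \<in> hsupp g" "q + r + of_nat k = s"
      by blast
    have eq: "s - q = r + of_nat k" "s - q - r = of_nat k" using x(4) by simp_all
    have 1: "s - q \<in> ?T" unfolding eq(1) using x(3) by blast
    have 2: "s - q - r \<in> ?N" unfolding eq(2) by blast
    have "(q, r) \<in> ?I"
      by (rule SigmaI; rule CollectI; rule conjI) (fact x(2) 1 x(3) 2)+
    moreover have "x = (\<lambda>(q, r). (nat \<lfloor>s - q - r\<rfloor>, q, r)) (q, r)" using eq by (simp add: x(1))
    ultimately show "x \<in> (\<lambda>(q, r). (nat \<lfloor>s - q - r\<rfloor>, q, r)) ` ?I" by (rule rev_image_eqI)
  qed
  then show ?thesis using finite_imageI[OF fin] by (rule finite_subset)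
qed

text \<open>The last clause spells out, coefficient by coefficient,
  $f * g = \sum_k C_k(f, g) \hbar^k$ with $C_k$ acting coefficientwise; the sum is finite by
  \<open>finite_star_index\<close>.\<close>
definition star_product ::
  "('p, 'e::real_normed_vector) chart set \<Rightarrow> (('p, 'e) chart \<Rightarrow> 'e \<Rightarrow> 'e \<Rightarrow> 'e \<Rightarrow> real) \<Rightarrow>
    (('p \<Rightarrow> complex) hseries \<Rightarrow> ('p \<Rightarrow> complex) hseries \<Rightarrow> ('p \<Rightarrow> complex) hseries) \<Rightarrow> bool" where
  "star_product A \<omega> star \<longleftrightarrow>
    (\<forall>f\<in>smooth_series A. \<forall>g\<in>smooth_series A. star f g \<in> smooth_series A) \<and>
    (\<forall>f\<in>smooth_series A. \<forall>g\<in>smooth_series A. \<forall>h\<in>smooth_series A.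
      star (star f g) h = star f (star g h) \<and>
      star (f + g) h = star f h + star g h \<and>
      star f (g + h) = star f g + star f h) \<and>
    (\<forall>a. \<forall>f\<in>smooth_series A. \<forall>g\<in>smooth_series A.
      star (a *\<^sub>h f) g = a *\<^sub>h star f g \<and> star f (a *\<^sub>h g) = a *\<^sub>h star f g) \<and>
    (\<exists>C. (\<forall>k. bidifferential A (C k)) \<and>
      (\<forall>f\<in>smooth_funs A. \<forall>g\<in>smooth_funs A. C 0 f g = f * g) \<and>
      (\<forall>k\<ge>1. \<forall>f\<in>smooth_funs A. C k 1 f = 0 \<and> C k f 1 = 0) \<and>
      (\<forall>f\<in>smooth_funs A. \<forall>g\<in>smooth_funs A. \<forall>p.
        C 1 f g p - C 1 g f p = \<i> * poisson_bracket A \<omega> f g p) \<and>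
      (\<forall>f\<in>smooth_series A. \<forall>g\<in>smooth_series A. \<forall>s.
        hcoeff (star f g) s =
          (\<Sum>(k, q, r)\<in>{(k, q, r). q \<in> hsupp f \<and> r \<in> hsupp g \<and> q + r + of_nat k = s}.
            C k (hcoeff f q) (hcoeff g r))))"

definition star_bracket ::
  "(('p \<Rightarrow> complex) hseries \<Rightarrow> ('p \<Rightarrow> complex) hseries \<Rightarrow> ('p \<Rightarrow> complex) hseries) \<Rightarrow>
    ('p \<Rightarrow> complex) hseries \<Rightarrow> ('p \<Rightarrow> complex) hseries \<Rightarrow> ('p \<Rightarrow> complex) hseries" where
  "star_bracket star f g = (1 / (himag * hbar)) *\<^sub>h (star f g - star g f)"

definition star_state ::
  "('p, 'e::real_normed_vector) chart set \<Rightarrow>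
    (('p \<Rightarrow> complex) hseries \<Rightarrow> ('p \<Rightarrow> complex) hseries \<Rightarrow> ('p \<Rightarrow> complex) hseries) \<Rightarrow>
    (('p \<Rightarrow> complex) hseries \<Rightarrow> complex hseries) \<Rightarrow> bool" where
  "star_state A star \<rho> \<longleftrightarrow>
    (\<forall>f\<in>smooth_series A. \<forall>g\<in>smooth_series A. \<rho> (f + g) = \<rho> f + \<rho> g) \<and>
    (\<forall>a. \<forall>f\<in>smooth_series A. \<rho> (a *\<^sub>h f) = a * \<rho> f) \<and>
    (\<forall>f\<in>smooth_series A. hnonneg (\<rho> (star (fcnj f) f))) \<and>
    \<rho> 1 = 1"

end

theory Submission
  imports Defs
begin

text \<open>
  Write \<open>E(f, g) = \<rho>(f * g)\<close>. Both determinants are Gram determinants of the family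
  \<open>\<delta>X\<close>: the left one belongs to the symmetrization \<open>(E(f, g) + E(g, f)) / 2\<close>, and the right
  one to the skew form \<open>(E(f, g) - E(g, f)) / (2 \<i>)\<close>, because the commutator of the \<open>X\<close> equals
  that of the \<open>\<delta>X\<close> (constants are central for a star product).

  A Gram determinant of a bilinear form changes by the factor \<open>(det P)\<^sup>2\<close> under a change of frame
  \<open>P\<close> (\<open>det_gram_change\<close>), the same factor for both forms. So equality of the two determinants
  passes from the frame formed by the \<open>\<delta>A'\<close> and their conjugates to the one formed by the
  \<open>\<delta>A\<close> and their conjugates, where the nonvanishing of the block determinant allows cancelling,
  and from there to the \<open>\<delta>X\<close>.

  In the first of these frames equality is a matter of signs. The form \<open>\<rho>(cnj f * g)\<close> is
  sesquilinear with nonnegative diagonal, so the usual Cauchy--Schwarz argument, valid over any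
  ordered field, shows that an element \<open>g\<close> of the Gel'fand ideal satisfies \<open>\<rho>(f * g) = 0\<close> and
  \<open>\<rho>(cnj g * f) = 0\<close> for every \<open>f\<close> (\<open>null_right\<close>, \<open>null_left\<close>). Hence the matrix of
  \<open>E\<close> in this frame has a single nonzero block \<open>Q\<close>, in the upper right corner, and the two Gram
  matrices have off-diagonal blocks \<open>Q/2, Q\<^sup>T/2\<close> and \<open>Q/(2\<i>), - Q\<^sup>T/(2\<i>)\<close>. They differ by
  row factors: \<open>- \<i>\<close> in the first \<open>m\<close> rows and \<open>\<i>\<close> in the last \<open>m\<close>, whose product is 1
  (\<open>det_sym_eq_det_skew\<close>).
\<close>

section \<open>Smooth functions form a complex vector space closed under conjugation\<close>

text \<open>Derivatives at points of an open set depend only on values in the set, which turns pointwise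
  formulas for derivatives into statements about \<^const>\<open>Ck_on\<close> by induction on the order.\<close>
lemma Ck_on_cong:
  assumes "open S" "\<And>x. x \<in> S \<Longrightarrow> f x = g x" "Ck_on k f S"
  shows "Ck_on k g S"
  using assms(2,3)
proof (induction k arbitrary: f g)
  case 0
  then show ?case using continuous_on_cong[of S S f g] by simp
next
  case (Suc k)
  have deriv: "(g has_derivative frechet_derivative f (at x)) (at x)" if x: "x \<in> S" for x
  proof -
    have "f differentiable at x"
      using Suc.prems(2) x assms(1) by (simp add: differentiable_on_eq_differentiable_at)
    then have "(f has_derivative frechet_derivative f (at x)) (at x)"
      by (simp add: frechet_derivative_works)
    then show ?thesis
      by (rule has_derivative_transform_within_open[OF _ assms(1) x]) (rule Suc.prems(1))
  qed
  have eq: "frechet_derivative f (at x) = frechet_derivative g (at x)" if "x \<in> S" for x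
    using frechet_derivative_at[OF deriv[OF that]] .
  have "g differentiable_on S"
    using deriv assms(1) by (auto simp: differentiable_on_eq_differentiable_at differentiable_def)
  moreover have "Ck_on k (\<lambda>x. frechet_derivative g (at x) v) S" for v
    by (rule Suc.IH[of "\<lambda>x. frechet_derivative f (at x) v"]) (use Suc.prems(2) eq in auto)
  ultimately show ?case by simp
qed

lemma Ck_on_add:
  assumes "open S" "Ck_on k f S" "Ck_on k g S"
  shows "Ck_on k (\<lambda>x. f x + g x) S"
  using assms(2,3)
proof (induction k arbitrary: f g)
  case 0
  then show ?case by (simp add: continuous_on_add)
next
  case (Suc k)
  have deriv: "frechet_derivative f (at x) v + frechet_derivative g (at x) v
      = frechet_derivative (\<lambda>x. f x + g x) (at x) v" if "x \<in> S" for x v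
  proof -
    have "f differentiable at x" "g differentiable at x"
      using Suc.prems that assms(1) by (simp_all add: differentiable_on_eq_differentiable_at)
    then have "((\<lambda>x. f x + g x) has_derivative
        (\<lambda>v. frechet_derivative f (at x) v + frechet_derivative g (at x) v)) (at x)"
      by (intro has_derivative_add) (simp_all add: frechet_derivative_works)
    from frechet_derivative_at[OF this] show ?thesis by (rule fun_cong)
  qed
  have "Ck_on k (\<lambda>x. frechet_derivative (\<lambda>x. f x + g x) (at x) v) S" for v
    by (rule Ck_on_cong[OF assms(1) deriv Suc.IH]) (use Suc.prems in auto)
  then show ?case using Suc.prems by (simp add: differentiable_on_add)
qed

text \<open>A bounded linear map commutes with differentiation. This covers both complex conjugation and
  multiplication by a complex constant.\<close>
lemma Ck_on_bounded_linear:
  assumes "open S" "bounded_linear L" "Ck_on k f S"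
  shows "Ck_on k (\<lambda>x. L (f x)) S"
  using assms(3)
proof (induction k arbitrary: f)
  case 0
  then show ?case by (simp add: bounded_linear.continuous_on[OF assms(2)])
next
  case (Suc k)
  have L: "((\<lambda>x. L (f x)) has_derivative (\<lambda>v. L (frechet_derivative f (at x) v))) (at x)"
    if "x \<in> S" for x
  proof -
    have "f differentiable at x"
      using Suc.prems that assms(1) by (simp add: differentiable_on_eq_differentiable_at)
    then show ?thesis
      by (intro bounded_linear.has_derivative[OF assms(2)]) (simp add: frechet_derivative_works)
  qed
  have deriv: "L (frechet_derivative f (at x) v) = frechet_derivative (\<lambda>x. L (f x)) (at x) v"
    if "x \<in> S" for x v
    using frechet_derivative_at[OF L[OF that]] by (rule fun_cong)
  have "(\<lambda>x. L (f x)) differentiable_on S"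
    using L assms(1) by (auto simp: differentiable_on_eq_differentiable_at differentiable_def)
  moreover have "Ck_on k (\<lambda>x. frechet_derivative (\<lambda>x. L (f x)) (at x) v) S" for v
    by (rule Ck_on_cong[OF assms(1) deriv Suc.IH]) (use Suc.prems in auto)
  ultimately show ?case by simp
qed

lemma Ck_on_const: "Ck_on k (\<lambda>x. c) S"
  by (induction k arbitrary: c) simp_all

lemma smooth_funs_one: "1 \<in> smooth_funs A"
  by (auto simp: smooth_funs_def smooth_on_def comp_def one_fun_def Ck_on_const)

lemma smooth_funs_zero: "0 \<in> smooth_funs A"
  by (auto simp: smooth_funs_def smooth_on_def comp_def zero_fun_def Ck_on_const)

lemma smooth_funs_add:
  assumes A: "smooth_atlas A" and f: "f \<in> smooth_funs A" and g: "g \<in> smooth_funs A"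
  shows "f + g \<in> smooth_funs A"
proof -
  have "Ck_on k ((f + g) \<circ> inv_into U \<phi>) (\<phi> ` U)" if c: "(U, \<phi>) \<in> A" for U \<phi> k
  proof -
    have "open (\<phi> ` U)" using A c unfolding smooth_atlas_def by blast
    moreover have "Ck_on k (f \<circ> inv_into U \<phi>) (\<phi> ` U)" "Ck_on k (g \<circ> inv_into U \<phi>) (\<phi> ` U)"
      using f g c unfolding smooth_funs_def smooth_on_def by blast+
    ultimately have "Ck_on k (\<lambda>x. (f \<circ> inv_into U \<phi>) x + (g \<circ> inv_into U \<phi>) x) (\<phi> ` U)"
      by (rule Ck_on_add)
    then show ?thesis by (simp add: comp_def plus_fun_def)
  qed
  then show ?thesis unfolding smooth_funs_def smooth_on_def by blast
qed

lemma smooth_funs_bounded_linear: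
  assumes A: "smooth_atlas A" and L: "bounded_linear L" and f: "f \<in> smooth_funs A"
  shows "(\<lambda>p. L (f p)) \<in> smooth_funs A"
proof -
  have "Ck_on k ((\<lambda>p. L (f p)) \<circ> inv_into U \<phi>) (\<phi> ` U)" if c: "(U, \<phi>) \<in> A" for U \<phi> k
  proof -
    have "open (\<phi> ` U)" using A c unfolding smooth_atlas_def by blast
    moreover have "Ck_on k (f \<circ> inv_into U \<phi>) (\<phi> ` U)"
      using f c unfolding smooth_funs_def smooth_on_def by blast
    ultimately have "Ck_on k (\<lambda>x. L ((f \<circ> inv_into U \<phi>) x)) (\<phi> ` U)"
      by (rule Ck_on_bounded_linear[OF _ L])
    then show ?thesis by (simp add: comp_def)
  qed
  then show ?thesis unfolding smooth_funs_def smooth_on_def by blast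
qed

section \<open>Scalars and conjugation act coefficientwise\<close>

lemma hcoeff_hcnj [simp]: "hcoeff (hcnj a) q = cnj (hcoeff a q)"
  by transfer simp

lemma hcoeff_hreal [simp]: "hcoeff (hreal a) q = complex_of_real (hcoeff a q)"
  by transfer simp

lemma hcoeff_fcnj [simp]: "hcoeff (fcnj f) q = (\<lambda>p. cnj (hcoeff f q p))"
  by transfer simp

lemma hcoeff_scalar [simp]: "hcoeff (scalar a) q = (\<lambda>p. hcoeff a q)"
  by transfer simp

text \<open>Each Cauchy coefficient is a finite sum of products. Since \<open>\<phi>\<close> may send nonzero coefficients
  to 0, the sum for the images is taken over the supports of the original series.\<close>
lemma coefficientwise_hom_mult:
  fixes F :: "'a::comm_ring_1 hseries \<Rightarrow> 'b::comm_ring_1 hseries"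
  assumes F: "\<And>a q. hcoeff (F a) q = \<phi> (hcoeff a q)"
    and zero: "\<phi> 0 = 0"
    and add: "\<And>x y. \<phi> (x + y) = \<phi> x + \<phi> y"
    and mult: "\<And>x y. \<phi> (x * y) = \<phi> x * \<phi> y"
  shows "F (a * b) = F a * F b"
proof (rule hseries_eqI)
  fix q
  have supp: "hsupp (F c) \<subseteq> hsupp c" for c
    by (auto simp: hsupp_def F zero)
  have "hcoeff (F (a * b)) q
      = (\<Sum>r\<in>{r\<in>hsupp a. q - r \<in> hsupp b}. \<phi> (hcoeff a r * hcoeff b (q - r)))"
    by (simp add: F hcoeff_mult sum_comp_morphism[of \<phi>, OF zero add, symmetric, unfolded comp_def])
  also have "\<dots> = hcoeff (F a * F b) q"
    by (subst hcoeff_mult_supset[OF wo_hsupp wo_hsupp supp supp]) (simp add: F mult)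
  finally show "hcoeff (F (a * b)) q = hcoeff (F a * F b) q" .
qed

lemma hcnj_mult: "hcnj (a * b) = hcnj a * hcnj b"
  by (rule coefficientwise_hom_mult[where \<phi> = cnj]) auto

lemma fcnj_mult: "fcnj (f * g) = fcnj f * fcnj g"
  by (rule coefficientwise_hom_mult[where \<phi> = "\<lambda>f p. cnj (f p)"]) (auto simp: fun_eq_iff)

lemma scalar_mult: "scalar (a * b) = scalar a * scalar b"
  by (rule coefficientwise_hom_mult[where \<phi> = "\<lambda>c p. c"]) (auto simp: fun_eq_iff)

lemma hcnj_add: "hcnj (a + b) = hcnj a + hcnj b"
  by (rule hseries_eqI) simp

lemma hcnj_minus: "hcnj (- a) = - hcnj a"
  by (rule hseries_eqI) simp

lemma hcnj_diff: "hcnj (a - b) = hcnj a - hcnj b"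
  by (rule hseries_eqI) simp

lemma hcnj_zero: "hcnj 0 = 0"
  by (rule hseries_eqI) simp

lemma hcnj_one: "hcnj 1 = 1"
  by (rule hseries_eqI) (simp add: hcoeff_1)

lemma hcnj_two: "hcnj 2 = 2"
  using hcnj_add[of 1 1] by (simp add: hcnj_one)

lemma hcnj_hcnj: "hcnj (hcnj a) = a"
  by (rule hseries_eqI) simp

lemma hcnj_himag: "hcnj himag = - himag"
  by (rule hseries_eqI) (simp add: himag_def hcoeff_monom)

lemma himag_square: "himag * himag = - 1"
  by (rule hseries_eqI) (simp add: himag_def hmonom_mult hcoeff_monom hcoeff_1)

lemma himag_nonzero: "himag \<noteq> 0"
  using himag_square by auto

lemma hbar_nonzero: "hbar \<noteq> 0"
proof
  assume "hbar = 0"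
  then have "hcoeff hbar 1 = 0" by simp
  then show False by (simp add: hbar_def hcoeff_monom)
qed

lemma hseries_two_nonzero: "(2 :: complex hseries) \<noteq> 0"
proof
  assume "(2 :: complex hseries) = 0"
  then have "hcoeff (1 + 1 :: complex hseries) 0 = 0" by simp
  then show False unfolding hcoeff_add by (simp add: hcoeff_1)
qed

lemma hcnj_half: "hcnj (1 / 2) = 1 / 2"
proof -
  have "hcnj (1 / 2) * 2 = hcnj (1 / 2 * 2)" by (simp only: hcnj_mult hcnj_two)
  also have "\<dots> = 1" using hseries_two_nonzero by (simp add: hcnj_one)
  finally show ?thesis using hseries_two_nonzero by (simp add: field_simps)
qed

lemma fcnj_add: "fcnj (f + g) = fcnj f + fcnj g"
  by (rule hseries_eqI) auto

lemma fcnj_diff: "fcnj (f - g) = fcnj f - fcnj g"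
  by (rule hseries_eqI) auto

lemma fcnj_fcnj: "fcnj (fcnj f) = f"
  by (rule hseries_eqI) auto

lemma fcnj_zero: "fcnj 0 = 0"
  by (rule hseries_eqI) auto

lemma fcnj_one: "fcnj 1 = 1"
  by (rule hseries_eqI) (auto simp: hcoeff_1 fun_eq_iff)

lemma fcnj_sum: "fcnj (sum f I) = (\<Sum>i\<in>I. fcnj (f i))"
  by (induction I rule: infinite_finite_induct) (simp_all add: fcnj_add fcnj_zero)

lemma fcnj_scalar: "fcnj (scalar a) = scalar (hcnj a)"
  by (rule hseries_eqI) auto

lemma fcnj_hscale: "fcnj (a *\<^sub>h f) = hcnj a *\<^sub>h fcnj f"
  by (simp add: hscale_def fcnj_mult fcnj_scalar)

lemma scalar_add: "scalar (a + b) = scalar a + scalar b"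
  by (rule hseries_eqI) auto

lemma scalar_one: "scalar 1 = 1"
  by (rule hseries_eqI) (auto simp: hcoeff_1 fun_eq_iff)

lemma hscale_one: "1 *\<^sub>h f = f"
  by (simp add: hscale_def scalar_one)

lemma hscale_hscale: "a *\<^sub>h b *\<^sub>h f = (a * b) *\<^sub>h f"
  by (simp add: hscale_def scalar_mult mult.assoc)

lemma hscale_add_right: "a *\<^sub>h (f + g) = a *\<^sub>h f + a *\<^sub>h g"
  by (simp add: hscale_def distrib_left)

lemma hscale_add_left: "(a + b) *\<^sub>h f = a *\<^sub>h f + b *\<^sub>h f"
  by (simp add: hscale_def scalar_add distrib_right)

lemma hscale_zero: "0 *\<^sub>h f = 0"
  using hscale_add_left[of 0 0 f] by simp

lemma hscale_minus_one: "(- 1) *\<^sub>h f = - f"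
  using hscale_add_left[of 1 "- 1" f] by (simp add: hscale_zero hscale_one eq_neg_iff_add_eq_0 add.commute)

lemma scalar_eq_hscale_one: "scalar a = a *\<^sub>h 1"
  by (simp add: hscale_def)

lemma smooth_series_add:
  "smooth_atlas A \<Longrightarrow> f \<in> smooth_series A \<Longrightarrow> g \<in> smooth_series A \<Longrightarrow> f + g \<in> smooth_series A"
  by (simp add: smooth_series_def smooth_funs_add)

lemma smooth_series_fcnj:
  "smooth_atlas A \<Longrightarrow> f \<in> smooth_series A \<Longrightarrow> fcnj f \<in> smooth_series A"
  by (simp add: smooth_series_def smooth_funs_bounded_linear[OF _ bounded_linear_cnj])

lemma smooth_series_one: "1 \<in> smooth_series A"
  by (simp add: smooth_series_def hcoeff_1 smooth_funs_one smooth_funs_zero)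

lemma smooth_series_hscale:
  assumes A: "smooth_atlas A" and f: "f \<in> smooth_series A"
  shows "a *\<^sub>h f \<in> smooth_series A"
proof -
  have product: "(\<lambda>p. hcoeff a r) * hcoeff f q \<in> smooth_funs A" for r q
    using smooth_funs_bounded_linear[OF A bounded_linear_mult_right[of "hcoeff a r"], of "hcoeff f q"] f
    by (simp add: smooth_series_def times_fun_def)
  have "(\<Sum>r\<in>I. g r) \<in> smooth_funs A" if "\<And>r. g r \<in> smooth_funs A" for g and I :: "rat set"
  proof (induction I rule: infinite_finite_induct)
    case (infinite I)
    then show ?case using smooth_funs_zero by (metis sum.infinite)
  next
    case empty
    show ?case using smooth_funs_zero by (metis sum.empty)
  next
    case (insert x I)
    then show ?case using smooth_funs_add[OF A that] by (metis sum.insert)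
  qed
  then show ?thesis
    by (simp add: smooth_series_def hscale_def hcoeff_mult product)
qed

section \<open>Positive forms over the complex series\<close>

text \<open>The form is conjugate linear in its first argument. It will be applied to
  \<open>\<rho>(cnj f * g)\<close>; Hermitian symmetry is not an axiom but a consequence of positivity.\<close>
locale hnonneg_form =
  fixes V :: "('p \<Rightarrow> complex) hseries set"
    and h :: "('p \<Rightarrow> complex) hseries \<Rightarrow> ('p \<Rightarrow> complex) hseries \<Rightarrow> complex hseries"
  assumes add_closed: "f \<in> V \<Longrightarrow> g \<in> V \<Longrightarrow> f + g \<in> V"
    and hscale_closed: "f \<in> V \<Longrightarrow> a *\<^sub>h f \<in> V"
    and add_left: "f \<in> V \<Longrightarrow> g \<in> V \<Longrightarrow> k \<in> V \<Longrightarrow> h (f + g) k = h f k + h g k"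
    and add_right: "f \<in> V \<Longrightarrow> g \<in> V \<Longrightarrow> k \<in> V \<Longrightarrow> h f (g + k) = h f g + h f k"
    and hscale_left: "f \<in> V \<Longrightarrow> g \<in> V \<Longrightarrow> h (a *\<^sub>h f) g = hcnj a * h f g"
    and hscale_right: "f \<in> V \<Longrightarrow> g \<in> V \<Longrightarrow> h f (a *\<^sub>h g) = a * h f g"
    and nonneg: "f \<in> V \<Longrightarrow> hnonneg (h f f)"
begin

lemma diag_real: "f \<in> V \<Longrightarrow> hcnj (h f f) = h f f"
  using nonneg[of f] by (auto simp: hnonneg_def intro: hseries_eqI)

lemma diag_expand:
  assumes "f \<in> V" "g \<in> V"
  shows "h (f + c *\<^sub>h g) (f + c *\<^sub>h g)
    = h f f + c * h f g + hcnj c * h g f + hcnj c * c * h g g"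
  using assms
  by (simp add: add_closed hscale_closed add_left add_right hscale_left hscale_right algebra_simps)

text \<open>Polarization: the diagonal values at \<open>f + c g\<close> are real; take \<open>c = 1\<close> and \<open>c = \<i>\<close>.\<close>
lemma hermitian:
  assumes f: "f \<in> V" and g: "g \<in> V"
  shows "hcnj (h f g) = h g f"
proof -
  have real: "hcnj (c * h f g + hcnj c * h g f) = c * h f g + hcnj c * h g f" for c
  proof -
    have "hcnj (h (f + c *\<^sub>h g) (f + c *\<^sub>h g)) = h (f + c *\<^sub>h g) (f + c *\<^sub>h g)"
      using f g by (intro diag_real add_closed hscale_closed)
    then show ?thesis
      using f g
      by (simp add: diag_expand hcnj_add hcnj_mult hcnj_hcnj diag_real algebra_simps)
  qed
  have sum: "hcnj (h f g) + hcnj (h g f) = h f g + h g f"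
    using real[of 1] by (simp add: hcnj_one hcnj_add)
  have "himag * (hcnj (h g f) - hcnj (h f g)) = himag * (h f g - h g f)"
    using real[of himag]
    by (simp add: hcnj_add hcnj_diff hcnj_mult hcnj_minus hcnj_himag algebra_simps)
  then have diff: "hcnj (h g f) - hcnj (h f g) = h f g - h g f"
    using himag_nonzero by simp
  have "2 * hcnj (h f g) = (hcnj (h f g) + hcnj (h g f)) - (hcnj (h g f) - hcnj (h f g))"
    by simp
  also have "\<dots> = 2 * h g f" unfolding sum diff by simp
  finally have "2 * hcnj (h f g) = 2 * h g f" .
  then show ?thesis using hseries_two_nonzero by simp
qed

text \<open>If \<open>h g g = 0\<close>, then \<open>h (f + c g) (f + c g)\<close> has no quadratic term in \<open>c\<close>, and
  when \<open>h f g\<close> is invertible the linear part can be given any real value, contradicting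
  positivity.\<close>
lemma null_right:
  assumes f: "f \<in> V" and g: "g \<in> V" and null: "h g g = 0"
  shows "h f g = 0"
proof (rule ccontr)
  assume w: "h f g \<noteq> 0"
  (* c is chosen so that the two linear terms are equal and the total value is -1. *)
  define d where "d = (h f f + 1) * (1 / 2)"
  define c where "c = - d / h f g"
  have "hcnj d = d"
    by (simp only: d_def hcnj_mult hcnj_add diag_real[OF f] hcnj_one hcnj_half)
  have 1: "c * h f g = - d" using w by (simp add: c_def)
  have 2: "hcnj c * h g f = - d"
    using arg_cong[OF 1, of hcnj] \<open>hcnj d = d\<close> by (simp add: hcnj_mult hermitian[OF f g] hcnj_minus)
  have "d + d = h f f + 1"
    using hseries_two_nonzero by (simp add: d_def flip: mult_2)
  then have "h (f + c *\<^sub>h g) (f + c *\<^sub>h g) = - 1"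
    using 1 2 null by (simp add: diag_expand[OF f g] algebra_simps)
  then have "hnonneg (- 1)"
    using nonneg[OF add_closed[OF f hscale_closed[OF g]]] by metis
  then obtain r :: "real hseries" where r: "0 \<le> r" "- 1 = hreal r"
    by (auto simp: hnonneg_def)
  have "r = - 1"
  proof (rule hseries_eqI)
    fix q
    have "complex_of_real (hcoeff r q) = hcoeff (- 1) q" by (simp only: r(2) hcoeff_hreal)
    also have "\<dots> = complex_of_real (hcoeff (- 1) q)" by (simp add: hcoeff_1)
    finally show "hcoeff r q = hcoeff (- 1) q" using of_real_eq_iff by blast
  qed
  then show False using r(1) by simp
qed

lemma null_left: "f \<in> V \<Longrightarrow> g \<in> V \<Longrightarrow> h f f = 0 \<Longrightarrow> h f g = 0"
  using null_right[of g f] hermitian[of g f] by (simp add: hcnj_zero)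

end

section \<open>Gram determinants\<close>

definition gram :: "('f \<Rightarrow> 'f \<Rightarrow> 'k) \<Rightarrow> nat \<Rightarrow> (nat \<Rightarrow> 'f) \<Rightarrow> 'k mat" where
  "gram b n Z = mat n n (\<lambda>(j, k). b (Z j) (Z k))"

locale hbilinear_form =
  fixes V :: "('p \<Rightarrow> complex) hseries set"
    and b :: "('p \<Rightarrow> complex) hseries \<Rightarrow> ('p \<Rightarrow> complex) hseries \<Rightarrow> complex hseries"
  assumes zero_closed: "0 \<in> V"
    and add_closed: "f \<in> V \<Longrightarrow> g \<in> V \<Longrightarrow> f + g \<in> V"
    and hscale_closed: "f \<in> V \<Longrightarrow> a *\<^sub>h f \<in> V"
    and add_left: "f \<in> V \<Longrightarrow> g \<in> V \<Longrightarrow> k \<in> V \<Longrightarrow> b (f + g) k = b f k + b g k"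
    and add_right: "f \<in> V \<Longrightarrow> g \<in> V \<Longrightarrow> k \<in> V \<Longrightarrow> b f (g + k) = b f g + b f k"
    and hscale_left: "f \<in> V \<Longrightarrow> g \<in> V \<Longrightarrow> b (a *\<^sub>h f) g = a * b f g"
    and hscale_right: "f \<in> V \<Longrightarrow> g \<in> V \<Longrightarrow> b f (a *\<^sub>h g) = a * b f g"
begin

lemma sum_closed: "(\<And>i. i \<in> I \<Longrightarrow> f i \<in> V) \<Longrightarrow> sum f I \<in> V"
  by (induction I rule: infinite_finite_induct) (auto intro: zero_closed add_closed)

lemma lincomb_left:
  assumes "finite I" "\<And>i. i \<in> I \<Longrightarrow> Z i \<in> V" "g \<in> V"
  shows "b (\<Sum>i\<in>I. c i *\<^sub>h Z i) g = (\<Sum>i\<in>I. c i * b (Z i) g)"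
  using assms
proof (induction I rule: finite_induct)
  case empty
  then show ?case using hscale_left[of g g 0] hscale_left[of 0 g 0] zero_closed
    by (simp add: hscale_zero)
next
  case (insert x I)
  then show ?case by (simp add: add_left hscale_left sum_closed hscale_closed)
qed

lemma lincomb_right:
  assumes "finite I" "\<And>i. i \<in> I \<Longrightarrow> Z i \<in> V" "g \<in> V"
  shows "b g (\<Sum>i\<in>I. c i *\<^sub>h Z i) = (\<Sum>i\<in>I. c i * b g (Z i))"
  using assms
proof (induction I rule: finite_induct)
  case empty
  then show ?case using hscale_right[of g 0 0] zero_closed by (simp add: hscale_zero)
next
  case (insert x I)
  then show ?case by (simp add: add_right hscale_right sum_closed hscale_closed)
qed

text \<open>The Gram matrix of the new family is \<open>P G P\<^sup>T\<close>.\<close>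
lemma det_gram_change:
  assumes P: "P \<in> carrier_mat n n"
    and Z: "\<And>j. j < n \<Longrightarrow> Z j \<in> V"
    and W: "\<And>a. a < n \<Longrightarrow> W a = (\<Sum>j<n. P $$ (a, j) *\<^sub>h Z j)"
  shows "Determinant.det (gram b n W) = (Determinant.det P)\<^sup>2 * Determinant.det (gram b n Z)"
proof -
  have G: "gram b n Z \<in> carrier_mat n n" by (simp add: gram_def)
  have "gram b n W = P * gram b n Z * transpose_mat P"
  proof (rule eq_matI)
    fix j k
    assume "j < dim_row (P * gram b n Z * transpose_mat P)" "k < dim_col (P * gram b n Z * transpose_mat P)"
    then have jk: "j < n" "k < n" using P by auto
    have Wk: "W k \<in> V" unfolding W[OF jk(2)] by (intro sum_closed hscale_closed Z) simp
    have "gram b n W $$ (j, k) = b (W j) (W k)" using jk by (simp add: gram_def)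
    also have "\<dots> = (\<Sum>i<n. P $$ (j, i) * b (Z i) (W k))"
      unfolding W[OF jk(1)] by (rule lincomb_left) (use Z Wk in auto)
    also have "\<dots> = (\<Sum>i<n. P $$ (j, i) * (\<Sum>l<n. P $$ (k, l) * b (Z i) (Z l)))"
      unfolding W[OF jk(2)] by (intro sum.cong refl arg_cong2[where f = times] lincomb_right) (use Z in auto)
    also have "\<dots> = (\<Sum>l<n. (\<Sum>i<n. P $$ (j, i) * b (Z i) (Z l)) * P $$ (k, l))"
      by (subst sum.swap[of _ "{..<n}" "{..<n}"] sum_distrib_left, 
          simp add: sum_distrib_left sum_distrib_right,
          subst sum.swap, simp add: mult_ac)
    also have "\<dots> = (P * gram b n Z * transpose_mat P) $$ (j, k)"
      using jk P by (simp add: scalar_prod_def gram_def lessThan_atLeast0)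
    finally show "gram b n W $$ (j, k) = (P * gram b n Z * transpose_mat P) $$ (j, k)" .
  qed (use P in \<open>auto simp: gram_def\<close>)
  then show ?thesis
    using P G by (simp add: Determinant.det_mult[where n = n] Determinant.det_transpose[OF P] power2_eq_square)
qed

end

lemma det_mult_rows:
  "Determinant.det (mat n n (\<lambda>(i, j). d i * M i j))
    = prod d {..<n} * Determinant.det (mat n n (\<lambda>(i, j). M i j :: 'a::comm_ring_1))"
proof -
  have rows: "(\<Prod>i = 0..<n. mat n n (\<lambda>(i, j). d i * M i j) $$ (i, p i))
      = prod d {..<n} * (\<Prod>i = 0..<n. mat n n (\<lambda>(i, j). M i j) $$ (i, p i))"
    if "p permutes {0..<n}" for p
    using permutes_in_image[OF that] by (simp add: lessThan_atLeast0 flip: prod.distrib)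
  show ?thesis
    unfolding Determinant.det_def
    by (simp only: dim_row_mat dim_col_mat if_True simp_thms sum_distrib_left, intro sum.cong refl)
      (simp only: mem_Collect_eq rows mult.left_commute)
qed

lemma prod_constant_on_halves:
  "(\<Prod>i<2 * m. if i < m then x else y) = (x * y :: 'a::comm_monoid_mult) ^ m"
proof -
  have "{..<2 * m} \<inter> {i. i < m} = {..<m}" "{..<2 * m} \<inter> - {i. i < m} = {m..<2 * m}"
    by auto
  then show ?thesis by (simp add: prod.If_cases power_mult_distrib)
qed

text \<open>The hypotheses say that only the upper right block of \<open>R\<close> can be nonzero. So at most one of
  \<open>R j k\<close> and \<open>R k j\<close> is nonzero, the former in the first \<open>m\<close> rows and the latter in the last
  \<open>m\<close>, and the skew part is the symmetric part with its rows multiplied by \<open>1/\<iota> = - \<iota>\<close> and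
  \<open>-1/\<iota> = \<iota>\<close> respectively.\<close>
lemma det_sym_eq_det_skew:
  fixes R :: "nat \<Rightarrow> nat \<Rightarrow> 'a::field"
  assumes i: "\<iota> * \<iota> = - 1"
    and right: "\<And>j k. j < 2 * m \<Longrightarrow> k < m \<Longrightarrow> R j k = 0"
    and left: "\<And>j k. m \<le> j \<Longrightarrow> j < 2 * m \<Longrightarrow> k < 2 * m \<Longrightarrow> R j k = 0"
  shows "Determinant.det (mat (2 * m) (2 * m) (\<lambda>(j, k). 1 / (2 * \<iota>) * R j k + - (1 / (2 * \<iota>)) * R k j))
    = Determinant.det (mat (2 * m) (2 * m) (\<lambda>(j, k). 1 / 2 * R j k + 1 / 2 * R k j))"
proof -
  let ?d = "\<lambda>j. if j < m then - \<iota> else \<iota>"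
  have "\<iota> \<noteq> 0" using i by auto
  then have s: "1 / (2 * \<iota>) = - \<iota> * (1 / 2)"
    using i by (simp add: divide_eq_eq field_simps)
  have rows: "1 / (2 * \<iota>) * R j k + - (1 / (2 * \<iota>)) * R k j = ?d j * (1 / 2 * R j k + 1 / 2 * R k j)"
    if "j < 2 * m" "k < 2 * m" for j k
    unfolding s using right[of k j] left[of j k] that by (cases "j < m") simp_all
  have "mat (2 * m) (2 * m) (\<lambda>(j, k). 1 / (2 * \<iota>) * R j k + - (1 / (2 * \<iota>)) * R k j)
      = mat (2 * m) (2 * m) (\<lambda>(j, k). ?d j * (1 / 2 * R j k + 1 / 2 * R k j))"
    by (rule cong_mat) (auto simp only: rows split_conv)
  moreover have "prod ?d {..<2 * m} = 1"
    by (simp add: prod_constant_on_halves i)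
  ultimately show ?thesis
    by (simp only: det_mult_rows) simp
qed

definition append_frame :: "nat \<Rightarrow> (nat \<Rightarrow> 'a) \<Rightarrow> (nat \<Rightarrow> 'a) \<Rightarrow> nat \<Rightarrow> 'a" where
  "append_frame m f g a = (if a < m then f a else g (a - m))"

lemma sum_append_frame:
  "(\<Sum>j<2 * m. c j *\<^sub>h append_frame m f g j) = (\<Sum>\<beta><m. c \<beta> *\<^sub>h f \<beta> + c (\<beta> + m) *\<^sub>h g \<beta>)"
proof -
  have "(\<Sum>j<m + m. c j *\<^sub>h append_frame m f g j)
      = (\<Sum>\<beta><m. c \<beta> *\<^sub>h f \<beta>) + (\<Sum>\<beta><m. c (\<beta> + m) *\<^sub>h g \<beta>)"
    by (subst lessThan_atLeast0, subst sum.atLeastLessThan_concat[symmetric, of 0 m])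
      (use sum.shift_bounds_nat_ivl[of "\<lambda>j. c j *\<^sub>h append_frame m f g j" 0 m m]
        in \<open>auto simp: append_frame_def lessThan_atLeast0\<close>)
  then show ?thesis by (simp add: mult_2 sum.distrib)
qed

section \<open>Expectation values of star products\<close>

locale star_state_on =
  fixes A :: "('p::{t2_space, second_countable_topology}, 'e::real_normed_vector) chart set"
    and \<omega> :: "('p, 'e) chart \<Rightarrow> 'e \<Rightarrow> 'e \<Rightarrow> 'e \<Rightarrow> real"
    and star :: "('p \<Rightarrow> complex) hseries \<Rightarrow> ('p \<Rightarrow> complex) hseries \<Rightarrow> ('p \<Rightarrow> complex) hseries"
    and \<rho> :: "('p \<Rightarrow> complex) hseries \<Rightarrow> complex hseries"
  assumes atlas: "smooth_atlas A"
    and star_product: "star_product A \<omega> star"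
    and state: "star_state A star \<rho>"
begin

abbreviation V where "V \<equiv> smooth_series A"

lemma star_closed: "f \<in> V \<Longrightarrow> g \<in> V \<Longrightarrow> star f g \<in> V"
  using star_product by (simp add: star_product_def)

lemma star_add_left: "f \<in> V \<Longrightarrow> g \<in> V \<Longrightarrow> k \<in> V \<Longrightarrow> star (f + g) k = star f k + star g k"
  using star_product by (simp add: star_product_def)

lemma star_add_right: "f \<in> V \<Longrightarrow> g \<in> V \<Longrightarrow> k \<in> V \<Longrightarrow> star f (g + k) = star f g + star f k"
  using star_product by (simp add: star_product_def)

lemma star_hscale_left: "f \<in> V \<Longrightarrow> g \<in> V \<Longrightarrow> star (a *\<^sub>h f) g = a *\<^sub>h star f g"
  using star_product by (simp add: star_product_def)

lemma star_hscale_right: "f \<in> V \<Longrightarrow> g \<in> V \<Longrightarrow> star f (a *\<^sub>h g) = a *\<^sub>h star f g"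
  using star_product by (simp add: star_product_def)

lemma state_add: "f \<in> V \<Longrightarrow> g \<in> V \<Longrightarrow> \<rho> (f + g) = \<rho> f + \<rho> g"
  using state by (simp add: star_state_def)

lemma state_hscale: "f \<in> V \<Longrightarrow> \<rho> (a *\<^sub>h f) = a * \<rho> f"
  using state by (simp add: star_state_def)

lemma minus_closed: "f \<in> V \<Longrightarrow> - f \<in> V"
  using smooth_series_hscale[OF atlas, of f "- 1"] by (simp add: hscale_minus_one)

lemma diff_closed: "f \<in> V \<Longrightarrow> g \<in> V \<Longrightarrow> f - g \<in> V"
  using smooth_series_add[OF atlas, of f "- g"] by (simp add: minus_closed)

lemma state_diff: "f \<in> V \<Longrightarrow> g \<in> V \<Longrightarrow> \<rho> (f - g) = \<rho> f - \<rho> g"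
  using state_add[of f "- g"] state_hscale[of g "- 1"] by (simp add: minus_closed hscale_minus_one)

lemma scalar_closed: "scalar a \<in> V"
  by (simp add: scalar_eq_hscale_one smooth_series_hscale[OF atlas] smooth_series_one)

text \<open>The operators \<open>C k\<close> with \<open>k \<ge> 1\<close> kill constants, so only the undeformed product
  \<open>C 0\<close> contributes.\<close>
lemma star_one:
  assumes f: "f \<in> V"
  shows "star f 1 = f" and "star 1 f = f"
proof -
  obtain C where "\<forall>f\<in>smooth_funs A. \<forall>g\<in>smooth_funs A. C 0 f g = f * g"
    and "\<forall>k\<ge>1. \<forall>f\<in>smooth_funs A. C k 1 f = 0 \<and> C k f 1 = 0"
    and "\<forall>f\<in>V. \<forall>g\<in>V. \<forall>s. hcoeff (star f g) s =
          (\<Sum>(k, q, r)\<in>{(k, q, r). q \<in> hsupp f \<and> r \<in> hsupp g \<and> q + r + of_nat k = s}.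
            C k (hcoeff f q) (hcoeff g r))"
    using star_product[unfolded star_product_def, THEN conjunct2, THEN conjunct2, THEN conjunct2]
    by (elim exE conjE) (rule that; assumption)
  then have C0: "\<And>f g. f \<in> smooth_funs A \<Longrightarrow> g \<in> smooth_funs A \<Longrightarrow> C 0 f g = f * g"
    and Ck: "\<And>k f. k \<ge> 1 \<Longrightarrow> f \<in> smooth_funs A \<Longrightarrow> C k 1 f = 0 \<and> C k f 1 = 0"
    and star: "\<And>f g s. f \<in> V \<Longrightarrow> g \<in> V \<Longrightarrow> hcoeff (star f g) s =
          (\<Sum>(k, q, r)\<in>{(k, q, r). q \<in> hsupp f \<and> r \<in> hsupp g \<and> q + r + of_nat k = s}.
            C k (hcoeff f q) (hcoeff g r))"
    by blast+
  have coeff: "hcoeff f q \<in> smooth_funs A" for q using f by (simp add: smooth_series_def)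
  have one: "r \<in> hsupp (1 :: ('p \<Rightarrow> complex) hseries) \<longleftrightarrow> r = 0" for r
    by (simp add: hsupp_def hcoeff_1)
  have C: "C k g 1 = (if k = 0 then g else 0)" "C k 1 g = (if k = 0 then g else 0)"
    if "g \<in> smooth_funs A" for k g
    using that C0[OF that smooth_funs_one] C0[OF smooth_funs_one that] Ck[of k g] by auto
  show "star f 1 = f"
  proof (rule hseries_eqI)
    fix s
    let ?I = "{(k, q, r). q \<in> hsupp f \<and> r \<in> hsupp (1 :: ('p \<Rightarrow> complex) hseries) \<and> q + r + of_nat k = s}"
    have "hcoeff (star f 1) s = (\<Sum>x\<in>?I. if x = (0, s, 0) then hcoeff f s else 0)"
      unfolding star[OF f smooth_series_one]
      by (rule sum.cong) (auto simp: one hcoeff_1 C coeff)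
    also have "\<dots> = (if (0, s, 0) \<in> ?I then hcoeff f s else 0)"
      by (rule sum.delta) (rule finite_star_index)
    also have "\<dots> = hcoeff f s" by (auto simp: one hsupp_def[of f])
    finally show "hcoeff (star f 1) s = hcoeff f s" .
  qed
  show "star 1 f = f"
  proof (rule hseries_eqI)
    fix s
    let ?I = "{(k, q, r). q \<in> hsupp (1 :: ('p \<Rightarrow> complex) hseries) \<and> r \<in> hsupp f \<and> q + r + of_nat k = s}"
    have "hcoeff (star 1 f) s = (\<Sum>x\<in>?I. if x = (0, 0, s) then hcoeff f s else 0)"
      unfolding star[OF smooth_series_one f]
      by (rule sum.cong) (auto simp: one hcoeff_1 C coeff)
    also have "\<dots> = (if (0, 0, s) \<in> ?I then hcoeff f s else 0)"
      by (rule sum.delta) (rule finite_star_index)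
    also have "\<dots> = hcoeff f s" by (auto simp: one hsupp_def[of f])
    finally show "hcoeff (star 1 f) s = hcoeff f s" .
  qed
qed

sublocale gns: hnonneg_form V "\<lambda>f g. \<rho> (star (fcnj f) g)"
proof
  show "hnonneg (\<rho> (star (fcnj f) f))" if "f \<in> V" for f
    using state that by (simp add: star_state_def)
qed (simp_all add: fcnj_add fcnj_hscale smooth_series_add[OF atlas] smooth_series_hscale[OF atlas]
    smooth_series_fcnj[OF atlas] star_closed state_add state_hscale
    star_add_left star_add_right star_hscale_left star_hscale_right)

text \<open>Hermitian symmetry against the unit.\<close>
lemma state_real:
  assumes "f \<in> V" "fcnj f = f"
  shows "hcnj (\<rho> f) = \<rho> f"
  using gns.hermitian[OF smooth_series_one assms(1)] assms by (simp add: fcnj_one star_one)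

lemma gelfand_ideal_right:
  assumes "f \<in> V" "g \<in> V" "\<rho> (star (fcnj g) g) = 0"
  shows "\<rho> (star f g) = 0"
  using gns.null_right[OF smooth_series_fcnj[OF atlas assms(1)] assms(2,3)] by (simp add: fcnj_fcnj)

lemma gelfand_ideal_left:
  assumes "f \<in> V" "g \<in> V" "\<rho> (star (fcnj g) g) = 0"
  shows "\<rho> (star (fcnj g) f) = 0"
  using gns.null_left[OF assms(2,1,3)] .

text \<open>Symmetrized products and commutators are both of this form.\<close>
lemma bilinear_combination:
  "hbilinear_form V (\<lambda>f g. s * \<rho> (star f g) + t * \<rho> (star g f))"
proof
  show "0 \<in> V" using scalar_closed[of 0] by (simp add: scalar_eq_hscale_one hscale_zero)
qed (simp_all add: smooth_series_add[OF atlas] smooth_series_hscale[OF atlas]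
    star_closed state_add state_hscale
    star_add_left star_add_right star_hscale_left star_hscale_right algebra_simps)

lemma star_diff_scalar_commutator:
  assumes f: "f \<in> V" and g: "g \<in> V"
  shows "star (f - scalar a) (g - scalar c) - star (g - scalar c) (f - scalar a) = star f g - star g f"
proof -
  have shift: "f - scalar a = f + (- a) *\<^sub>h 1" for f :: "('p \<Rightarrow> complex) hseries" and a
    using hscale_add_left[of a "- a" 1] by (simp add: scalar_eq_hscale_one hscale_zero algebra_simps)
  show ?thesis
    unfolding shift using f g
    by (simp add: star_add_left star_add_right star_hscale_left star_hscale_right star_one
        smooth_series_one smooth_series_add[OF atlas] smooth_series_hscale[OF atlas]
        hscale_hscale hscale_add_right mult.commute)
qed

end

section \<open>Intelligent states\<close>

theorem proposition6p2:
  fixes A :: "('p::{t2_space, second_countable_topology}, 'e::real_normed_vector) chart set"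
    and \<omega> :: "('p, 'e) chart \<Rightarrow> 'e \<Rightarrow> 'e \<Rightarrow> 'e \<Rightarrow> real"
    and star :: "('p \<Rightarrow> complex) hseries \<Rightarrow> ('p \<Rightarrow> complex) hseries \<Rightarrow> ('p \<Rightarrow> complex) hseries"
    and \<rho> :: "('p \<Rightarrow> complex) hseries \<Rightarrow> complex hseries"
    and m :: nat
    and X \<delta>X \<delta>A \<delta>A' :: "nat \<Rightarrow> ('p \<Rightarrow> complex) hseries"
    and u v :: "nat \<Rightarrow> nat \<Rightarrow> complex hseries"
  assumes "smooth_atlas A"
    and "symplectic_form A \<omega>"
    and "star_product A \<omega> star"
    and "star_state A star \<rho>"
    and "\<And>j. j < 2 * m \<Longrightarrow> X j \<in> smooth_series A"
    and "\<And>j. j < 2 * m \<Longrightarrow> fcnj (X j) = X j"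
    and "\<And>j. j < 2 * m \<Longrightarrow> \<delta>X j = X j - scalar (\<rho> (X j))"
    and "\<And>\<alpha>. \<alpha> < m \<Longrightarrow> \<delta>A \<alpha> = (1 / 2) *\<^sub>h (\<delta>X \<alpha> + himag *\<^sub>h \<delta>X (\<alpha> + m))"
    and "Determinant.det (four_block_mat
           (mat m m (\<lambda>(\<alpha>, \<beta>). u \<alpha> \<beta>)) (mat m m (\<lambda>(\<alpha>, \<beta>). v \<alpha> \<beta>))
           (mat m m (\<lambda>(\<alpha>, \<beta>). hcnj (v \<alpha> \<beta>))) (mat m m (\<lambda>(\<alpha>, \<beta>). hcnj (u \<alpha> \<beta>)))) \<noteq> 0"
    and "\<And>\<alpha>. \<alpha> < m \<Longrightarrow>
           \<delta>A' \<alpha> = (\<Sum>\<beta><m. u \<alpha> \<beta> *\<^sub>h \<delta>A \<beta> + v \<alpha> \<beta> *\<^sub>h fcnj (\<delta>A \<beta>))"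
    and "\<And>\<alpha>. \<alpha> < m \<Longrightarrow> \<rho> (star (fcnj (\<delta>A' \<alpha>)) (\<delta>A' \<alpha>)) = 0"
  shows "Determinant.det (mat (2 * m) (2 * m)
           (\<lambda>(j, k). (1 / 2) * \<rho> (star (\<delta>X j) (\<delta>X k) + star (\<delta>X k) (\<delta>X j))))
       = Determinant.det (mat (2 * m) (2 * m)
           (\<lambda>(j, k). (hbar / 2) * \<rho> (star_bracket star (X j) (X k))))"
proof -
  interpret star_state_on A \<omega> star \<rho>
    by unfold_locales fact+
  note X = assms(5) and X_real = assms(6) and \<delta>X = assms(7) and \<delta>A = assms(8)
    and \<delta>A' = assms(10) and ideal = assms(11)
  let ?s = "1 / (2 * himag)"
  let ?sym = "\<lambda>f g. 1 / 2 * \<rho> (star f g) + 1 / 2 * \<rho> (star g f)"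
  let ?skew = "\<lambda>f g. ?s * \<rho> (star f g) + - ?s * \<rho> (star g f)"
  (* In the frame Z = (delta A, conjugates) the change to Z' is the given block matrix B,
     and delta X = T Z. The change T runs towards delta X, so that its determinant multiplies
     both sides of an equation already established and never has to be cancelled. *)
  define Z where "Z = append_frame m \<delta>A (\<lambda>\<alpha>. fcnj (\<delta>A \<alpha>))"
  define Z' where "Z' = append_frame m \<delta>A' (\<lambda>\<alpha>. fcnj (\<delta>A' \<alpha>))"
  define B where "B = four_block_mat
    (mat m m (\<lambda>(\<alpha>, \<beta>). u \<alpha> \<beta>)) (mat m m (\<lambda>(\<alpha>, \<beta>). v \<alpha> \<beta>))
    (mat m m (\<lambda>(\<alpha>, \<beta>). hcnj (v \<alpha> \<beta>))) (mat m m (\<lambda>(\<alpha>, \<beta>). hcnj (u \<alpha> \<beta>)))"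
  define G where "G s t W =
    Determinant.det (gram (\<lambda>f g. s * \<rho> (star f g) + t * \<rho> (star g f)) (2 * m) W)" for s t W
  define T where "T = mat (2 * m) (2 * m) (\<lambda>(j, k).
    if j < m then (if k = j \<or> k = j + m then 1 else 0)
    else (if k = j then himag else if k + m = j then - himag else 0))"

  have \<delta>X_V: "\<delta>X j \<in> V" if "j < 2 * m" for j
    using that by (simp add: \<delta>X diff_closed X scalar_closed)
  (* Reality of delta X needs that rho takes real elements to real series. *)
  have \<delta>X_real: "fcnj (\<delta>X j) = \<delta>X j" if "j < 2 * m" for j
    using that by (simp add: \<delta>X fcnj_diff X_real fcnj_scalar state_real X)
  have cnj_\<delta>A: "fcnj (\<delta>A \<alpha>) = (1 / 2) *\<^sub>h (\<delta>X \<alpha> + (- himag) *\<^sub>h \<delta>X (\<alpha> + m))" if "\<alpha> < m" for \<alpha>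
    using that by (simp add: \<delta>A fcnj_hscale fcnj_add \<delta>X_real hcnj_half hcnj_himag)
  have \<delta>A_V: "\<delta>A \<alpha> \<in> V" if "\<alpha> < m" for \<alpha>
    using that by (simp add: \<delta>A \<delta>X_V gns.add_closed gns.hscale_closed)
  have Z_V: "Z j \<in> V" if "j < 2 * m" for j
    using that by (simp add: Z_def append_frame_def \<delta>A_V smooth_series_fcnj[OF assms(1)])

  have half: "1 / 2 + 1 / 2 = (1 :: complex hseries)"
    using hseries_two_nonzero by (simp add: field_simps)
  have \<delta>X_first_half: "\<delta>X \<alpha> = 1 *\<^sub>h \<delta>A \<alpha> + 1 *\<^sub>h fcnj (\<delta>A \<alpha>)" if "\<alpha> < m" for \<alpha>
  proof -
    have "1 *\<^sub>h \<delta>A \<alpha> + 1 *\<^sub>h fcnj (\<delta>A \<alpha>)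
      = (1 / 2 + 1 / 2) *\<^sub>h \<delta>X \<alpha> + ((1 / 2) * himag + (1 / 2) * (- himag)) *\<^sub>h \<delta>X (\<alpha> + m)"
      unfolding cnj_\<delta>A[OF that] unfolding \<delta>A[OF that]
      by (simp only: hscale_one mult_1_left hscale_add_right hscale_hscale hscale_add_left add_ac)
    then show ?thesis by (simp add: half hscale_one hscale_zero)
  qed
  have \<delta>X_second_half: "\<delta>X (\<alpha> + m) = (- himag) *\<^sub>h \<delta>A \<alpha> + himag *\<^sub>h fcnj (\<delta>A \<alpha>)" if "\<alpha> < m" for \<alpha>
  proof -
    have "(- himag) *\<^sub>h \<delta>A \<alpha> + himag *\<^sub>h fcnj (\<delta>A \<alpha>)
      = ((- himag) * (1 / 2) + himag * (1 / 2)) *\<^sub>h \<delta>X \<alpha>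
        + ((- himag) * ((1 / 2) * himag) + himag * ((1 / 2) * (- himag))) *\<^sub>h \<delta>X (\<alpha> + m)"
      unfolding cnj_\<delta>A[OF that] unfolding \<delta>A[OF that]
      by (simp only: hscale_one mult_1_left hscale_add_right hscale_hscale hscale_add_left add_ac)
    moreover have "(- i) * (h * i) + i * (h * (- i)) = (h + h) * (- (i * i))"
      for i h :: "complex hseries"
      by (simp add: algebra_simps)
    ultimately show ?thesis by (simp only: half himag_square) (simp add: hscale_one hscale_zero)
  qed
  have X_from_Z: "\<delta>X j = (\<Sum>k<2 * m. T $$ (j, k) *\<^sub>h Z k)" if j: "j < 2 * m" for j
  proof -
    let ?\<alpha> = "if j < m then j else j - m"
    have "(\<Sum>k<2 * m. T $$ (j, k) *\<^sub>h Z k)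
      = (\<Sum>\<beta><m. T $$ (j, \<beta>) *\<^sub>h \<delta>A \<beta> + T $$ (j, \<beta> + m) *\<^sub>h fcnj (\<delta>A \<beta>))"
      by (simp add: Z_def sum_append_frame)
    also have "\<dots> = (\<Sum>\<beta><m. if \<beta> = ?\<alpha> then \<delta>X j else 0)"
    proof (rule sum.cong[OF refl])
      fix \<beta> assume "\<beta> \<in> {..<m}"
      then have \<beta>: "\<beta> < m" by simp
      show "T $$ (j, \<beta>) *\<^sub>h \<delta>A \<beta> + T $$ (j, \<beta> + m) *\<^sub>h fcnj (\<delta>A \<beta>) = (if \<beta> = ?\<alpha> then \<delta>X j else 0)"
        using \<delta>X_first_half[OF \<beta>] \<delta>X_second_half[OF \<beta>] j \<beta> by (auto simp: T_def hscale_zero)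
    qed
    also have "\<dots> = \<delta>X j" using j by (auto simp: less_diff_conv2)
    finally show ?thesis ..
  qed

  have Z'_from_Z: "Z' a = (\<Sum>j<2 * m. B $$ (a, j) *\<^sub>h Z j)" if a: "a < 2 * m" for a
  proof -
    have "(\<Sum>j<2 * m. B $$ (a, j) *\<^sub>h Z j)
      = (\<Sum>\<beta><m. B $$ (a, \<beta>) *\<^sub>h \<delta>A \<beta> + B $$ (a, \<beta> + m) *\<^sub>h fcnj (\<delta>A \<beta>))"
      by (simp add: Z_def sum_append_frame)
    also have "\<dots> = Z' a"
      using a
      by (auto simp: B_def Z'_def append_frame_def \<delta>A' fcnj_sum fcnj_add fcnj_hscale fcnj_fcnj add_ac
          intro!: sum.cong)
    finally show ?thesis ..
  qed
  interpret sym: hbilinear_form V ?sym by (rule bilinear_combination)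
  have Z'_V: "Z' a \<in> V" if "a < 2 * m" for a
    unfolding Z'_from_Z[OF that] by (intro sym.sum_closed sym.hscale_closed Z_V) simp
  then have \<delta>A'_V: "\<delta>A' \<alpha> \<in> V" if "\<alpha> < m" for \<alpha>
    using that Z'_V[of \<alpha>] by (simp add: Z'_def append_frame_def)
  (* The Gel'fand ideal condition enters here: products with a delta A' on the right, or with the
     conjugate of one on the left, have expectation 0. *)
  have "Determinant.det (gram ?skew (2 * m) Z') = Determinant.det (gram ?sym (2 * m) Z')"
    unfolding gram_def
  proof (rule det_sym_eq_det_skew[OF himag_square])
    show "\<rho> (star (Z' j) (Z' k)) = 0" if "j < 2 * m" "k < m" for j k
      using gelfand_ideal_right[OF Z'_V[OF that(1)] \<delta>A'_V[OF that(2)] ideal[OF that(2)]] that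
      by (simp add: Z'_def append_frame_def)
    show "\<rho> (star (Z' j) (Z' k)) = 0" if "m \<le> j" "j < 2 * m" "k < 2 * m" for j k
    proof -
      have "j - m < m" using that by simp
      then show ?thesis
        using gelfand_ideal_left[OF Z'_V[OF that(3)] \<delta>A'_V ideal] that
        by (simp add: Z'_def append_frame_def)
    qed
  qed
  then have Z': "G ?s (- ?s) Z' = G (1 / 2) (1 / 2) Z'" by (simp only: G_def)
  have "B \<in> carrier_mat (2 * m) (2 * m)"
    by (simp add: B_def mult_2)
  then have "G s t Z' = (Determinant.det B)\<^sup>2 * G s t Z" for s t
    unfolding G_def
    by (rule hbilinear_form.det_gram_change[OF bilinear_combination _ Z_V Z'_from_Z])
  moreover have "Determinant.det B \<noteq> 0" using assms(9) by (simp add: B_def)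
  ultimately have Z: "G ?s (- ?s) Z = G (1 / 2) (1 / 2) Z"
    using Z' by simp
  have "T \<in> carrier_mat (2 * m) (2 * m)"
    by (simp add: T_def)
  then have "G s t \<delta>X = (Determinant.det T)\<^sup>2 * G s t Z" for s t
    unfolding G_def
    by (rule hbilinear_form.det_gram_change[OF bilinear_combination _ Z_V X_from_Z])
  then have "G ?s (- ?s) \<delta>X = G (1 / 2) (1 / 2) \<delta>X" using Z by simp
  then have "Determinant.det (gram ?skew (2 * m) \<delta>X) = Determinant.det (gram ?sym (2 * m) \<delta>X)"
    by (simp only: G_def)
  moreover have "gram ?sym (2 * m) \<delta>X = mat (2 * m) (2 * m)
      (\<lambda>(j, k). (1 / 2) * \<rho> (star (\<delta>X j) (\<delta>X k) + star (\<delta>X k) (\<delta>X j)))"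
    unfolding gram_def
    by (rule cong_mat) (simp_all add: state_add star_closed \<delta>X_V distrib_left)
  (* The factor hbar / 2 cancels the 1 / (i hbar) of the star bracket down to 1 / (2 i), and the
     commutator does not see the scalars subtracted in delta X. *)
  moreover have "gram ?skew (2 * m) \<delta>X = mat (2 * m) (2 * m)
      (\<lambda>(j, k). (hbar / 2) * \<rho> (star_bracket star (X j) (X k)))"
    unfolding gram_def
  proof (rule cong_mat)
    fix j k assume jk: "j < 2 * m" "k < 2 * m"
    have "star (\<delta>X j) (\<delta>X k) - star (\<delta>X k) (\<delta>X j) = star (X j) (X k) - star (X k) (X j)"
      using jk by (simp add: \<delta>X star_diff_scalar_commutator X)
    then have "\<rho> (star (X j) (X k) - star (X k) (X j))
        = \<rho> (star (\<delta>X j) (\<delta>X k)) - \<rho> (star (\<delta>X k) (\<delta>X j))"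
      using jk by (metis state_diff star_closed \<delta>X_V)
    moreover have "\<rho> (star_bracket star (X j) (X k))
        = 1 / (himag * hbar) * \<rho> (star (X j) (X k) - star (X k) (X j))"
      unfolding star_bracket_def
      using jk by (intro state_hscale diff_closed star_closed X)
    ultimately have bracket: "\<rho> (star_bracket star (X j) (X k))
        = 1 / (himag * hbar) * (\<rho> (star (\<delta>X j) (\<delta>X k)) - \<rho> (star (\<delta>X k) (\<delta>X j)))"
      by (simp only:)
    show "(case (j, k) of (j, k) \<Rightarrow> ?skew (\<delta>X j) (\<delta>X k))
      = (case (j, k) of (j, k) \<Rightarrow> (hbar / 2) * \<rho> (star_bracket star (X j) (X k)))"
      unfolding split_conv bracket
      using hbar_nonzero himag_nonzero hseries_two_nonzero by (simp add: field_simps)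
  qed simp_all
  ultimately show ?thesis by simp
qed

end
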